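(* Let $\alpha>0$, $p>1$, $r\geq1$, and let $g$ be an entire function on $\mathbb{C}$. Let $J_gf(z):=\int_0^zf(\zeta)g'(\zeta)d\zeta$, $z\in\mathbb{C}$, for entire $f$. (1) If $p\leq2$, or $p>2$ and $r\leq2$, then $J_g$ is $r$-summing on $F^p_{\alpha}$ if and only if $g$ is constant. (2) If $p>2$ and $r>2$, then $J_g$ is $r$-summing on $F^p_{\alpha}$ if and only if $g(z)=az+b$ for some $a,b\in\mathbb{C}$.
   Context: $F^p_\alpha$ is the standard Fock space of entire functions $f$ with $\|f\|^p_{F^p_{\alpha}}:=\int_{\mathbb{C}}|f(z)|^pe^{-\frac{p\alpha}{2}|z|^2}dA(z)<\infty$, where $dA$ is Lebesgue measure on $\mathbb{C}$. For $r\ge1$, a linear operator $T:X\to Y$ between Banach spaces is $r$-summing if there is $C\ge0$ such that $\left(\sum_{j=1}^n\|Tx_j\|_Y^r\right)^{1/r}\le C\sup_{x^*\in B_{X^*}}\left(\sum_{j=1}^n|x^*(x_j)|^r\right)^{1/r}$ for every finite sequence $x_1,\dots,x_n\in X$ ($B_{X^*}$ the unit ball of $X^*$). "$J_g$ is $r$-summing on $F^p_\alpha$" means that $J_g$ maps $F^p_\alpha$ into itself and $J_g:F^p_\alpha\to F^p_\alpha$ is $r$-summing. *)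

theory Defs
  imports "HOL-Complex_Analysis.Complex_Analysis"
begin

definition fock_weighted :: "real \<Rightarrow> real \<Rightarrow> (complex \<Rightarrow> complex) \<Rightarrow> complex \<Rightarrow> real" where
  "fock_weighted \<alpha> p f z = cmod (f z) powr p * exp (- (p * \<alpha> / 2) * (cmod z)\<^sup>2)"

definition fock_space :: "real \<Rightarrow> real \<Rightarrow> (complex \<Rightarrow> complex) set" where
  "fock_space \<alpha> p = {f. f holomorphic_on UNIV \<and> integrable lborel (fock_weighted \<alpha> p f)}"

definition fock_norm :: "real \<Rightarrow> real \<Rightarrow> (complex \<Rightarrow> complex) \<Rightarrow> real" where
  "fock_norm \<alpha> p f = (LINT z|lborel. fock_weighted \<alpha> p f z) powr (1 / p)"

text \<open>
  The Fock spaces depend on the real parameters \<open>\<alpha>\<close> and \<open>p\<close>, so they cannot be types. A complex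
  normed space of functions is therefore given by its carrier \<open>X\<close>, a set of complex-valued
  functions with the pointwise vector space operations, together with its norm \<open>N\<close>.
\<close>

definition linear_operator ::
    "('a \<Rightarrow> complex) set \<Rightarrow> ('b \<Rightarrow> complex) set \<Rightarrow> (('a \<Rightarrow> complex) \<Rightarrow> ('b \<Rightarrow> complex)) \<Rightarrow> bool" where
  "linear_operator X Y T \<longleftrightarrow>
     (\<forall>f\<in>X. T f \<in> Y) \<and>
     (\<forall>f\<in>X. \<forall>h\<in>X. T (\<lambda>z. f z + h z) = (\<lambda>w. T f w + T h w)) \<and>
     (\<forall>c. \<forall>f\<in>X. T (\<lambda>z. c * f z) = (\<lambda>w. c * T f w))"

text \<open>
  The closed unit ball of the dual space. The values of a functional outside \<open>X\<close> are irrelevant.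
\<close>

definition dual_ball ::
    "('a \<Rightarrow> complex) set \<Rightarrow> (('a \<Rightarrow> complex) \<Rightarrow> real) \<Rightarrow> (('a \<Rightarrow> complex) \<Rightarrow> complex) set" where
  "dual_ball X N = {\<phi>.
     (\<forall>f\<in>X. \<forall>h\<in>X. \<phi> (\<lambda>z. f z + h z) = \<phi> f + \<phi> h) \<and>
     (\<forall>c. \<forall>f\<in>X. \<phi> (\<lambda>z. c * f z) = c * \<phi> f) \<and>
     (\<forall>f\<in>X. cmod (\<phi> f) \<le> N f)}"

text \<open>
  The supremum below is one of real numbers; it is taken over a nonempty set that is bounded above,
  see \<open>dual_ball_nonempty\<close> and \<open>dual_ball_bdd_above\<close>.
\<close>

definition r_summing ::
    "real \<Rightarrow> ('a \<Rightarrow> complex) set \<Rightarrow> (('a \<Rightarrow> complex) \<Rightarrow> real) \<Rightarrow>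
     ('b \<Rightarrow> complex) set \<Rightarrow> (('b \<Rightarrow> complex) \<Rightarrow> real) \<Rightarrow>
     (('a \<Rightarrow> complex) \<Rightarrow> ('b \<Rightarrow> complex)) \<Rightarrow> bool" where
  "r_summing r X NX Y NY T \<longleftrightarrow>
     linear_operator X Y T \<and>
     (\<exists>C\<ge>0. \<forall>n::nat. \<forall>x. (\<forall>j\<in>{1..n}. x j \<in> X) \<longrightarrow>
        (\<Sum>j=1..n. NY (T (x j)) powr r) powr (1 / r)
          \<le> C * (SUP \<phi>\<in>dual_ball X NX. (\<Sum>j=1..n. cmod (\<phi> (x j)) powr r) powr (1 / r)))"

lemma dual_ball_nonempty:
  assumes "\<And>f. f \<in> X \<Longrightarrow> 0 \<le> N f"
  shows "dual_ball X N \<noteq> {}"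
proof -
  have "(\<lambda>_. 0) \<in> dual_ball X N"
    using assms by (simp add: dual_ball_def)
  then show ?thesis by blast
qed

lemma dual_ball_bdd_above:
  fixes n :: nat
  assumes "r \<ge> 1" "\<And>j. j \<in> {1..n} \<Longrightarrow> x j \<in> X"
  shows "bdd_above ((\<lambda>\<phi>. (\<Sum>j=1..n. cmod (\<phi> (x j)) powr r) powr (1 / r)) ` dual_ball X N)"
proof (rule bdd_aboveI2)
  fix \<phi> assume "\<phi> \<in> dual_ball X N"
  then have "cmod (\<phi> (x j)) \<le> N (x j)" if "j \<in> {1..n}" for j
    using assms(2)[OF that] by (simp add: dual_ball_def)
  then show "(\<Sum>j=1..n. cmod (\<phi> (x j)) powr r) powr (1 / r) \<le> (\<Sum>j=1..n. N (x j) powr r) powr (1 / r)"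
    using assms(1) by (intro powr_mono2 sum_mono sum_nonneg) auto
qed

definition volterra :: "(complex \<Rightarrow> complex) \<Rightarrow> (complex \<Rightarrow> complex) \<Rightarrow> complex \<Rightarrow> complex" where
  "volterra g f z = contour_integral (linepath 0 z) (\<lambda>\<zeta>. f \<zeta> * deriv g \<zeta>)"

definition volterra_r_summing :: "real \<Rightarrow> real \<Rightarrow> real \<Rightarrow> (complex \<Rightarrow> complex) \<Rightarrow> bool" where
  "volterra_r_summing r \<alpha> p g \<longleftrightarrow>
     r_summing r (fock_space \<alpha> p) (fock_norm \<alpha> p) (fock_space \<alpha> p) (fock_norm \<alpha> p) (volterra g)"

end

theory Submission
  imports Defs
begin

text \<open>
  Let \<open>k\<^sub>w(z) = exp (\<alpha> z cnj w - \<alpha> \<bar>w\<bar>\<^sup>2 / 2)\<close> be the normalised reproducing kernels, with \<open>w\<close> running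
  through the Gaussian integers in the first quadrant. They behave like the unit vectors of \<open>\<ell>\<^sup>p\<close>: the norm of
  \<open>\<Sum>c\<^sub>w k\<^sub>w\<close> is at most a constant times the \<open>\<ell>\<^sup>p\<close>-norm of \<open>c\<close>, so by duality they are weakly \<open>q\<close>-summable
  for every \<open>q \<ge> p / (p - 1)\<close>. Point evaluation of \<open>(J\<^sub>g k\<^sub>w)' = k\<^sub>w g'\<close> at \<open>w\<close> gives
  \<open>\<bar>g'(w)\<bar> \<le> C (1 + \<bar>w\<bar>) \<parallel>J\<^sub>g k\<^sub>w\<parallel>\<close>. Boundedness of \<open>J\<^sub>g\<close> thus makes \<open>g'\<close> affine, and summability along
  the integers makes it constant.

  If \<open>g'\<close> is a nonzero constant, then \<open>J\<^sub>g k\<^sub>w\<close> is essentially \<open>k\<^sub>w / w\<close>. For \<open>p \<ge> 2\<close> and \<open>r \<le> 2\<close>, testing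
  2-summability on the kernels bounds \<open>\<Sum>1 / \<bar>w\<bar>\<^sup>2\<close> over the lattice, which diverges. For \<open>p \<le> 2\<close> the same
  bound results from the random sums \<open>\<Sum>\<plusminus>\<bar>w\<bar> powr (1 - 2 / p) k\<^sub>w\<close> and Khinchine's inequality.

  Conversely, if \<open>g'\<close> is constant, integration along rays gives
  \<open>\<bar>J\<^sub>g f(z)\<bar> exp (- \<alpha> \<bar>z\<bar>\<^sup>2 / 2) \<le> C \<parallel>f\<parallel> / (1 + \<bar>z\<bar>)\<close>. The functionals \<open>f \<mapsto> J\<^sub>g f(z)\<close> are therefore available as
  test functionals, and \<open>r\<close>-summability for \<open>2 < r \<le> p\<close> follows by integrating over \<open>z\<close>, because
  \<open>(1 + \<bar>z\<bar>) powr (- r)\<close> is integrable over the plane.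
\<close>

subsection \<open>Elementary inequalities and integrals\<close>

text \<open>
  With \<open>u\<close> chosen suitably, this inequality stands in for Hoelder's inequality in all that follows.
\<close>

lemma le_split_powr:
  fixes x u q :: real
  assumes "0 \<le> x" "0 < u" "1 \<le> q"
  shows "x \<le> u + u powr (1 - q) * x powr q"
proof (cases "x \<le> u")
  case True
  then show ?thesis by (simp add: add_increasing2)
next
  case False
  have "x = x powr (1 - q) * x powr q"
    using False assms by (simp add: powr_add[symmetric])
  also have "\<dots> \<le> u powr (1 - q) * x powr q"
    using False assms by (intro mult_right_mono powr_mono2') auto
  finally show ?thesis using assms by linarith
qed

text \<open>The choice \<open>u = V powr (1 / q)\<close> balances the two terms and yields the
  Hoelder bound; if \<open>V = 0\<close>, small \<open>u\<close> gives \<open>X \<le> 0\<close>. The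
  factor \<open>M + 1\<close> is not sharp, but only the existence of constants matters
  below.\<close>

lemma le_of_split:
  fixes X V M q :: real
  assumes "1 \<le> q" "0 \<le> V" "0 \<le> M" and le: "\<And>u. 0 < u \<Longrightarrow> X \<le> u * M + u powr (1 - q) * V"
  shows "X \<le> (M + 1) * V powr (1 / q)"
proof (cases "V = 0")
  case True
  have "X \<le> e" if "0 < e" for e
  proof -
    have "X \<le> (e / (M + 1)) * M"
      using le[of "e / (M + 1)"] that assms True by simp
    also have "\<dots> \<le> e"
      using that assms by (simp add: field_simps)
    finally show ?thesis .
  qed
  then have "X \<le> 0"
    using dense_ge by blast
  then show ?thesis using True by simp
next
  case False
  then have V: "0 < V" using assms by simp
  have "(V powr (1 / q)) powr (1 - q) * V = V powr ((1 - q) / q) * V powr 1"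
    using V by (simp add: powr_powr)
  also have "\<dots> = V powr (1 / q)"
    using assms by (simp only: powr_add[symmetric]) (simp add: field_simps)
  finally show ?thesis
    using le[of "V powr (1 / q)"] V by (simp add: algebra_simps)
qed

text \<open>Hoelder's inequality for point masses \<open>w i\<close> of total at most
  \<open>M\<close>: split each \<open>x i\<close> by \<open>le_split_powr\<close> and choose
  \<open>u\<close> by \<open>le_of_split\<close>.\<close>

lemma powr_sum_le:
  fixes w x :: "'i \<Rightarrow> real" and M p :: real
  assumes "finite I" "\<And>i. i \<in> I \<Longrightarrow> 0 \<le> w i" "\<And>i. i \<in> I \<Longrightarrow> 0 \<le> x i"
    and "1 \<le> p" "(\<Sum>i\<in>I. w i) \<le> M"
  shows "(\<Sum>i\<in>I. w i * x i) powr p \<le> (M + 1) powr p * (\<Sum>i\<in>I. w i * x i powr p)"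
proof -
  define V where "V = (\<Sum>i\<in>I. w i * x i powr p)"
  have M: "0 \<le> M"
    using assms by (meson order_trans sum_nonneg)
  have V: "0 \<le> V"
    unfolding V_def using assms by (intro sum_nonneg) auto
  have "(\<Sum>i\<in>I. w i * x i) \<le> (M + 1) * V powr (1 / p)"
  proof (rule le_of_split)
    fix u :: real assume u: "0 < u"
    have "(\<Sum>i\<in>I. w i * x i) \<le> (\<Sum>i\<in>I. w i * (u + u powr (1 - p) * x i powr p))"
      using assms u by (intro sum_mono mult_left_mono le_split_powr) auto
    also have "\<dots> = u * (\<Sum>i\<in>I. w i) + u powr (1 - p) * V"
      by (simp add: V_def sum.distrib sum_distrib_left algebra_simps)
    also have "\<dots> \<le> u * M + u powr (1 - p) * V"
      using u assms by simp
    finally show "(\<Sum>i\<in>I. w i * x i) \<le> u * M + u powr (1 - p) * V" .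
  qed (use assms M V in auto)
  then have "(\<Sum>i\<in>I. w i * x i) powr p \<le> ((M + 1) * V powr (1 / p)) powr p"
    using assms by (intro powr_mono2 sum_nonneg) auto
  also have "\<dots> = (M + 1) powr p * V"
    using M V assms by (simp add: powr_mult powr_powr)
  finally show ?thesis by (simp add: V_def)
qed

section \<open>Integrability on the line and in the plane\<close>

lemma integrable_one_plus_abs_powr:
  fixes s :: real
  assumes s: "1 < s"
  shows "integrable lborel (\<lambda>x::real. (1 + \<bar>x\<bar>) powr (- s))"
proof -
  let ?f = "\<lambda>x::real. (1 + \<bar>x\<bar>) powr (- s)"
  have [measurable]: "?f \<in> borel_measurable borel" by measurable
  have half: "(\<integral>\<^sup>+x. ennreal (?f x) * indicator {0..} x \<partial>lborel) < \<infinity>"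
  proof -
    have "(\<integral>\<^sup>+x. ennreal (?f x) * indicator {0..} x \<partial>lborel)
        = ennreal (0 - (1 + 0) powr (1 - s) / (1 - s))"
    proof (rule nn_integral_FTC_atLeast)
      fix x :: real assume x: "0 \<le> x"
      have "((\<lambda>x. (1 + x) powr (1 - s) / (1 - s)) has_real_derivative (1 + x) powr (- s)) (at x)"
      proof -
        have "((\<lambda>x. 1 + x) has_real_derivative 1) (at x)"
          by (auto intro!: derivative_eq_intros)
        from DERIV_cdivide[OF DERIV_fun_powr[OF this, of "1 - s"], of "1 - s"] show ?thesis
          using x s by simp
      qed
      then show "((\<lambda>x. (1 + x) powr (1 - s) / (1 - s)) has_real_derivative ?f x) (at x)"
        using x by simp
    next
      have "((\<lambda>x::real. (1 + x) powr (1 - s)) \<longlongrightarrow> 0) at_top"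
        using s by (intro tendsto_neg_powr filterlim_tendsto_add_at_top[OF tendsto_const]) (auto intro: filterlim_ident)
      then show "((\<lambda>x. (1 + x) powr (1 - s) / (1 - s)) \<longlongrightarrow> 0) at_top"
        using tendsto_divide[OF _ tendsto_const, of _ 0 at_top "1 - s"] s by simp
    qed auto
    then show ?thesis by simp
  qed
  have "(\<integral>\<^sup>+x. ennreal (?f x) * indicator {..0} x \<partial>lborel)
      = (\<integral>\<^sup>+x. ennreal (?f x) * indicator {..0} x \<partial>distr lborel borel uminus)"
    by (simp add: lborel_distr_uminus)
  also have "\<dots> = (\<integral>\<^sup>+x. ennreal (?f x) * indicator {0..} x \<partial>lborel)"
    by (subst nn_integral_distr) (auto intro!: nn_integral_cong simp: indicator_def)
  finally have half': "(\<integral>\<^sup>+x. ennreal (?f x) * indicator {..0} x \<partial>lborel) < \<infinity>"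
    using half by simp
  have "(\<integral>\<^sup>+x. ennreal (?f x) \<partial>lborel)
      \<le> (\<integral>\<^sup>+x. ennreal (?f x) * indicator {0..} x + ennreal (?f x) * indicator {..0} x \<partial>lborel)"
    by (intro nn_integral_mono) (auto simp: indicator_def)
  also have "\<dots> = (\<integral>\<^sup>+x. ennreal (?f x) * indicator {0..} x \<partial>lborel)
      + (\<integral>\<^sup>+x. ennreal (?f x) * indicator {..0} x \<partial>lborel)"
    by (intro nn_integral_add) auto
  also have "\<dots> < \<infinity>" using half half' by simp
  finally show ?thesis
    by (intro integrableI_bounded) auto
qed

lemma integrable_lborel_prod_Basis:
  fixes h :: "real \<Rightarrow> real"
  assumes h: "integrable lborel h"
  shows "integrable lborel (\<lambda>z::'a::euclidean_space. \<Prod>b\<in>Basis. h (z \<bullet> b))"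
proof -
  have [measurable]: "h \<in> borel_measurable borel"
    using borel_measurable_integrable[OF h] by simp
  interpret product_sigma_finite "\<lambda>_::'a. lborel :: real measure" ..
  have "integrable (\<Pi>\<^sub>M b\<in>(Basis :: 'a set). lborel) (\<lambda>x. \<Prod>b\<in>Basis. h (x b))"
    using h by (intro product_integrable_prod) auto
  moreover have "(\<Prod>b\<in>Basis. h ((\<Sum>c\<in>Basis. x c *\<^sub>R c) \<bullet> b)) = (\<Prod>b\<in>Basis. h (x b))"
    for x :: "'a \<Rightarrow> real"
    by (intro prod.cong) (auto simp: inner_sum_left_Basis)
  ultimately have "integrable (distr (\<Pi>\<^sub>M b\<in>Basis. lborel) borel (\<lambda>f. \<Sum>b\<in>Basis. f b *\<^sub>R b))
      (\<lambda>z::'a. \<Prod>b\<in>Basis. h (z \<bullet> b))"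
    by (subst integrable_distr_eq) auto
  then show ?thesis by (simp add: lborel_eq[symmetric])
qed

text \<open>Polar coordinates are avoided: \<open>cmod z\<close> dominates both coordinates, so
  halving the exponent bounds the function by a product of one-variable functions, each integrable
  because \<open>p / 2 > 1\<close>.\<close>

lemma integrable_one_plus_cmod_powr:
  fixes p :: real
  assumes p: "2 < p"
  shows "integrable lborel (\<lambda>z::complex. (1 + cmod z) powr (- p))"
proof (rule Bochner_Integration.integrable_bound)
  show "integrable lborel (\<lambda>z::complex. \<Prod>b\<in>Basis. (1 + \<bar>z \<bullet> b\<bar>) powr (- (p / 2)))"
    using p by (intro integrable_lborel_prod_Basis integrable_one_plus_abs_powr) auto
  show "AE z in lborel. norm ((1 + cmod z) powr (- p))
      \<le> norm (\<Prod>b\<in>Basis. (1 + \<bar>z \<bullet> b\<bar>) powr (- (p / 2)))"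
  proof (rule AE_I2)
    fix z :: complex
    have "(1 + cmod z) powr (- p) = (1 + cmod z) powr (- (p / 2)) * (1 + cmod z) powr (- (p / 2))"
      by (simp add: powr_add[symmetric])
    also have "\<dots> \<le> (1 + \<bar>Re z\<bar>) powr (- (p / 2)) * (1 + \<bar>Im z\<bar>) powr (- (p / 2))"
      using p by (intro mult_mono powr_mono2') (auto simp: abs_Re_le_cmod abs_Im_le_cmod)
    finally show "norm ((1 + cmod z) powr (- p)) \<le> norm (\<Prod>b\<in>Basis. (1 + \<bar>z \<bullet> b\<bar>) powr (- (p / 2)))"
      by (simp add: Basis_complex_def abs_mult)
  qed
qed measurable

text \<open>The quadratic Taylor bound makes \<open>exp (\<beta> * R\<^sup>2)\<close> at least a
  constant times \<open>(1 + R) ^ 4\<close>, which reduces the claim to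
  \<open>integrable_one_plus_cmod_powr\<close>.\<close>

lemma integrable_gaussian_complex:
  fixes \<beta> :: real
  assumes \<beta>: "0 < \<beta>"
  shows "integrable lborel (\<lambda>z::complex. exp (- \<beta> * (cmod z)\<^sup>2))"
proof (rule Bochner_Integration.integrable_bound)
  show "integrable lborel (\<lambda>z::complex. (8 * (1 + 2 / \<beta>\<^sup>2)) * (1 + cmod z) powr (- 4))"
    by (intro integrable_mult_right integrable_one_plus_cmod_powr) auto
  show "AE z::complex in lborel. norm (exp (- \<beta> * (cmod z)\<^sup>2))
      \<le> norm ((8 * (1 + 2 / \<beta>\<^sup>2)) * (1 + cmod z) powr (- 4))"
  proof (rule AE_I2)
    fix z :: complex
    define R where "R = cmod z"
    have R: "0 \<le> R" by (simp add: R_def)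
    have "(1 + R)\<^sup>2 \<le> 2 * (1 + R\<^sup>2)"
      using zero_le_power2[of "1 - R"] by (simp add: power2_eq_square algebra_simps)
    then have "((1 + R)\<^sup>2)\<^sup>2 \<le> (2 * (1 + R\<^sup>2))\<^sup>2"
      by (intro power_mono) auto
    also have "\<dots> \<le> 8 * (1 + R ^ 4)"
    proof -
      have "0 \<le> (1 - R\<^sup>2)\<^sup>2" by simp
      then show ?thesis by (simp add: power2_eq_square power4_eq_xxxx algebra_simps)
    qed
    finally have 1: "(1 + R) ^ 4 \<le> 8 * (1 + R ^ 4)"
      by (simp flip: power_mult)
    have e: "1 + \<beta> * R\<^sup>2 + (\<beta> * R\<^sup>2)\<^sup>2 / 2 \<le> exp (\<beta> * R\<^sup>2)"
      using \<beta> by (intro exp_lower_Taylor_quadratic) auto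
    have "\<beta>\<^sup>2 / 2 * R ^ 4 \<le> exp (\<beta> * R\<^sup>2)"
    proof -
      have "0 \<le> \<beta> * R\<^sup>2" using \<beta> by simp
      then have "(\<beta> * R\<^sup>2)\<^sup>2 / 2 \<le> exp (\<beta> * R\<^sup>2)"
        using e by linarith
      then show ?thesis by (simp add: power_mult_distrib flip: power_mult)
    qed
    then have "R ^ 4 \<le> 2 / \<beta>\<^sup>2 * exp (\<beta> * R\<^sup>2)"
      using \<beta> by (simp add: field_simps)
    moreover have "1 \<le> exp (\<beta> * R\<^sup>2)" using \<beta> by simp
    ultimately have "(1 + R) ^ 4 \<le> 8 * (exp (\<beta> * R\<^sup>2) + 2 / \<beta>\<^sup>2 * exp (\<beta> * R\<^sup>2))"
      by (intro order_trans[OF 1] mult_left_mono add_mono) auto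
    then have "(1 + R) ^ 4 \<le> 8 * (1 + 2 / \<beta>\<^sup>2) * exp (\<beta> * R\<^sup>2)"
      by (simp add: algebra_simps)
    then have "exp (- (\<beta> * R\<^sup>2)) \<le> 8 * (1 + 2 / \<beta>\<^sup>2) / (1 + R) ^ 4"
      using R by (simp add: exp_minus field_simps)
    also have "\<dots> = 8 * (1 + 2 / \<beta>\<^sup>2) * (1 + R) powr (- 4)"
      using R by (simp add: powr_minus powr_numeral divide_inverse)
    finally show "norm (exp (- \<beta> * (cmod z)\<^sup>2)) \<le> norm ((8 * (1 + 2 / \<beta>\<^sup>2)) * (1 + cmod z) powr (- 4))"
      by (simp add: R_def abs_mult)
  qed
qed measurable

text \<open>
  Cauchy's formula on the circle of radius 1 around \<open>u\<close>, averaged over the centres \<open>u\<close> near \<open>w\<close>: this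
  needs only the translation invariance of Lebesgue measure, not polar coordinates.
\<close>

lemma cmod_le_integral_ball:
  fixes h :: "complex \<Rightarrow> complex"
  assumes h: "h holomorphic_on UNIV"
  shows "cmod (h w) * measure lborel (ball (0::complex) (1/2))
    \<le> 2 * (LINT z|lborel. indicator (ball w (3/2)) z * cmod (h z))"
proof -
  define e where "e t = exp (2 * of_real pi * \<i> * of_real t)" for t :: real
  have conth: "continuous_on A h" for A
    using h by (meson continuous_on_subset holomorphic_on_imp_continuous_on subset_UNIV)
  have [measurable]: "h \<in> borel_measurable borel"
    using conth by (rule borel_measurable_continuous_onI)
  have conte: "continuous_on A e" for A
    unfolding e_def by (intro continuous_intros)
  have [measurable]: "e \<in> borel_measurable borel"
    using conte by (rule borel_measurable_continuous_onI)
  have e1: "cmod (e t) = 1" for t by (simp add: e_def)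
  have [measurable]: "(\<lambda>x. h (snd x + e (fst x))) \<in> borel_measurable (borel \<Otimes>\<^sub>M borel)"
    unfolding borel_prod
    by (intro borel_measurable_continuous_onI continuous_on_compose2[OF conth[of UNIV]]
        continuous_on_compose2[OF conte[of UNIV]] continuous_intros) auto
  have [measurable]: "Measurable.pred (borel \<Otimes>\<^sub>M borel) (\<lambda>x::real \<times> complex. snd x \<in> ball w (1/2))"
    by (rule pred_sets2[OF _ measurable_snd]) auto
  \<comment> \<open>If \<open>u\<close> is within 1/2 of \<open>w\<close>, the unit circle around
    \<open>u\<close> encloses \<open>w\<close> and keeps distance at least 1/2 from it, so the
    Cauchy kernel costs only a factor 2.\<close>
  have circle: "ennreal (cmod (h w)) \<le> (\<integral>\<^sup>+t. ennreal (indicator {0..1} t * (2 * cmod (h (u + e t)))) \<partial>lborel)"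
    if u: "dist w u < 1/2" for u
  proof -
    let ?F = "\<lambda>t. 2 * cmod (h (u + e t))"
    have contF: "continuous_on {0..1} ?F"
      by (intro continuous_intros continuous_on_compose2[OF conth[of UNIV]] conte) auto
    have cauchy: "((\<lambda>z. h z / (z - w)) has_contour_integral (2 * of_real pi * \<i> * h w)) (circlepath u 1)"
      using u by (intro Cauchy_integral_circlepath_simple holomorphic_on_subset[OF h])
        (auto simp: dist_norm norm_minus_commute)
    then have int: "((\<lambda>t. h (u + e t) / (u + e t - w) * (2 * of_real pi * \<i> * e t))
        has_integral (2 * of_real pi * \<i> * h w)) {0..1}"
    proof -
      have "circlepath u 1 t = u + e t" for t
        by (simp add: circlepath e_def)
      moreover have "vector_derivative (circlepath u 1) (at t) = 2 * of_real pi * \<i> * e t" for t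
        unfolding vector_derivative_circlepath by (simp add: e_def)
      ultimately show ?thesis
        using cauchy unfolding has_contour_integral by (simp only:)
    qed
    have "cmod (2 * of_real pi * \<i> * h w) \<le> integral {0..1} (\<lambda>t. (2 * pi) * ?F t)"
      unfolding integral_unique[OF int, symmetric]
    proof (rule integral_norm_bound_integral)
      show "(\<lambda>t. (2 * pi) * ?F t) integrable_on {0..1}"
        by (intro integrable_continuous_interval continuous_intros contF)
      fix t :: real
      have "1 / 2 \<le> cmod (u + e t - w)"
      proof -
        have "cmod (e t) \<le> cmod (u + e t - w) + cmod (w - u)"
          using norm_triangle_ineq[of "u + e t - w" "w - u"] by simp
        then show ?thesis using u by (simp add: e1 dist_norm)
      qed
      then have "cmod (h (u + e t)) / cmod (u + e t - w) \<le> 2 * cmod (h (u + e t))"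
        using mult_left_mono[of "1/2" "cmod (u + e t - w)" "cmod (h (u + e t))"]
        by (cases "cmod (u + e t - w) = 0") (auto simp: divide_le_eq algebra_simps)
      then have "cmod (h (u + e t)) / cmod (u + e t - w) * (2 * pi) \<le> 2 * cmod (h (u + e t)) * (2 * pi)"
        by (intro mult_right_mono) auto
      then show "cmod (h (u + e t) / (u + e t - w) * (2 * of_real pi * \<i> * e t)) \<le> (2 * pi) * ?F t"
        by (simp add: norm_mult norm_divide e1 mult.commute mult.left_commute)
    qed (use int in auto)
    then have "cmod (h w) \<le> integral {0..1} ?F"
      by (simp add: norm_mult)
    also have "\<dots> = (LINT t:{0..1}|lborel. ?F t)"
      using set_borel_integral_eq_integral(2)[OF borel_integrable_atLeastAtMost'[OF contF]] by simp
    finally have "ennreal (cmod (h w)) \<le> ennreal (LINT t|lborel. indicator {0..1} t * ?F t)"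
      by (intro ennreal_leI) (simp only: set_lebesgue_integral_def real_scaleR_def)
    also have "\<dots> = (\<integral>\<^sup>+t. ennreal (indicator {0..1} t * ?F t) \<partial>lborel)"
      using borel_integrable_atLeastAtMost'[OF contF]
      by (intro nn_integral_eq_integral[symmetric]) (auto simp: set_integrable_def)
    finally show ?thesis .
  qed
  let ?G = "\<lambda>z. indicator (ball w (3/2)) z * cmod (h z)"
  have mG: "?G \<in> borel_measurable borel"
    by (intro borel_measurable_times borel_measurable_indicator borel_measurable_norm) auto
  have intG: "integrable lborel ?G"
  proof (rule Bochner_Integration.integrable_bound)
    show "integrable lborel (\<lambda>z. indicator (cball w (3/2)) z *\<^sub>R cmod (h z))"
      by (intro borel_integrable_compact continuous_intros conth) auto
  qed (auto simp: indicator_def)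
  have "ennreal (cmod (h w) * measure lborel (ball (0::complex) (1/2)))
      = ennreal (cmod (h w)) * emeasure lborel (ball w (1/2))"
  proof -
    have "emeasure lborel (ball w (1/2)) = emeasure lborel (ball (0::complex) (1/2))"
      by (simp add: emeasure_ball)
    also have "\<dots> = ennreal (measure lborel (ball (0::complex) (1/2)))"
      by (intro emeasure_eq_ennreal_measure) (simp add: emeasure_ball ennreal_mult_eq_top_iff)
    finally show ?thesis by (simp add: ennreal_mult)
  qed
  \<comment> \<open>The area of the small ball becomes an integral over the admissible centres
    \<open>u\<close>, so that \<open>circle\<close> can be averaged. After the integrals are
    exchanged, \<open>t\<close> is fixed and the shift by \<open>e t\<close> carries
    \<open>ball w (1/2)\<close> into \<open>ball w (3/2)\<close>.\<close>
  also have "\<dots> = (\<integral>\<^sup>+u. ennreal (cmod (h w)) * indicator (ball w (1/2)) u \<partial>lborel)"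
    by (subst nn_integral_cmult_indicator) auto
  also have "\<dots> \<le> (\<integral>\<^sup>+u. (\<integral>\<^sup>+t. ennreal (indicator {0..1} t * (indicator (ball w (1/2)) u * (2 * cmod (h (u + e t))))) \<partial>lborel) \<partial>lborel)"
    by (intro nn_integral_mono) (use circle in \<open>auto simp: indicator_def dist_commute\<close>)
  also have "\<dots> = (\<integral>\<^sup>+t. (\<integral>\<^sup>+u. ennreal (indicator {0..1} t * (indicator (ball w (1/2)) u * (2 * cmod (h (u + e t))))) \<partial>lborel) \<partial>lborel)"
    by (rule lborel_pair.Fubini') measurable
  also have "\<dots> \<le> (\<integral>\<^sup>+t. indicator {0..1::real} t * (2 * (\<integral>\<^sup>+z. ennreal (?G z) \<partial>lborel)) \<partial>lborel)"
  proof (intro nn_integral_mono)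
    fix t :: real
    have "(\<integral>\<^sup>+u. ennreal (indicator {0..1} t * (indicator (ball w (1/2)) u * (2 * cmod (h (u + e t))))) \<partial>lborel)
        \<le> (\<integral>\<^sup>+u. indicator {0..1} t * (2 * ennreal (?G (e t + u))) \<partial>lborel)"
    proof (intro nn_integral_mono)
      fix u
      have "dist w (e t + u) < 3/2" if "dist w u < 1/2"
        using that dist_triangle[of w "e t + u" u] e1[of t] by (simp add: dist_norm norm_minus_commute)
      then show "ennreal (indicator {0..1} t * (indicator (ball w (1/2)) u * (2 * cmod (h (u + e t)))))
          \<le> indicator {0..1} t * (2 * ennreal (?G (e t + u)))"
        by (auto simp: indicator_def add.commute ennreal_mult)
    qed
    also have "\<dots> = indicator {0..1} t * (2 * (\<integral>\<^sup>+u. ennreal (?G (e t + u)) \<partial>lborel))"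
    proof -
      have "(\<lambda>u. ennreal (?G (e t + u))) \<in> borel_measurable lborel"
        by (rule measurable_compose[of "(+) (e t)" lborel borel "\<lambda>z. ennreal (?G z)"]) (use mG in auto)
      then show ?thesis
        by (subst nn_integral_cmult, measurable)+
    qed
    also have "(\<integral>\<^sup>+u. ennreal (?G (e t + u)) \<partial>lborel) = (\<integral>\<^sup>+z. ennreal (?G z) \<partial>distr lborel borel ((+) (e t)))"
      by (subst nn_integral_distr) (use mG in auto)
    also have "\<dots> = (\<integral>\<^sup>+z. ennreal (?G z) \<partial>lborel)"
      by (simp add: lborel_distr_plus)
    finally show "(\<integral>\<^sup>+u. ennreal (indicator {0..1} t * (indicator (ball w (1/2)) u * (2 * cmod (h (u + e t))))) \<partial>lborel)
        \<le> indicator {0..1} t * (2 * (\<integral>\<^sup>+z. ennreal (?G z) \<partial>lborel))" .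
  qed
  also have "\<dots> = 2 * (\<integral>\<^sup>+z. ennreal (?G z) \<partial>lborel)"
    by (subst nn_integral_multc) auto
  also have "\<dots> = ennreal (2 * (LINT z|lborel. ?G z))"
    by (subst nn_integral_eq_integral[OF intG]) (auto simp: ennreal_mult)
  finally show ?thesis
    by (subst (asm) ennreal_le_iff) (auto intro!: integral_nonneg_AE)
qed

subsection \<open>Fock spaces\<close>

text \<open>The weight is applied before the power \<open>p\<close>, so one function serves all
  exponents: its \<open>p\<close>-th power is the integrand of the Fock norm, and its uniform bounds
  play the role of the case of infinite exponent.\<close>

definition fock_density :: "real \<Rightarrow> (complex \<Rightarrow> complex) \<Rightarrow> complex \<Rightarrow> real" where
  "fock_density \<alpha> f z = cmod (f z) * exp (- (\<alpha> / 2) * (cmod z)\<^sup>2)"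

lemma fock_density_nonneg [simp]: "0 \<le> fock_density \<alpha> f z"
  by (simp add: fock_density_def)

lemma fock_weighted_eq: "fock_weighted \<alpha> p f z = fock_density \<alpha> f z powr p"
  by (simp add: fock_weighted_def fock_density_def powr_mult exp_powr_real algebra_simps)

lemma fock_density_scale: "fock_density \<alpha> (\<lambda>z. c * f z) z = cmod c * fock_density \<alpha> f z"
  by (simp add: fock_density_def norm_mult)

lemma fock_density_add:
  "fock_density \<alpha> (\<lambda>z. f z + h z) z \<le> fock_density \<alpha> f z + fock_density \<alpha> h z"
  unfolding fock_density_def
  by (metis distrib_right exp_ge_zero mult_right_mono norm_triangle_ineq)

lemma fock_density_sum:
  "fock_density \<alpha> (\<lambda>z. \<Sum>i\<in>I. c i * f i z) z \<le> (\<Sum>i\<in>I. cmod (c i) * fock_density \<alpha> (f i) z)"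
proof -
  have "cmod (\<Sum>i\<in>I. c i * f i z) \<le> (\<Sum>i\<in>I. cmod (c i) * cmod (f i z))"
    by (intro sum_norm_le) (simp add: norm_mult)
  then show ?thesis
    unfolding fock_density_def mult.assoc[symmetric] sum_distrib_right[symmetric]
    by (intro mult_right_mono) auto
qed

lemma fock_density_measurable [measurable]:
  assumes "f holomorphic_on UNIV"
  shows "fock_density \<alpha> f \<in> borel_measurable borel"
proof -
  have [measurable]: "f \<in> borel_measurable borel"
    by (intro borel_measurable_continuous_onI holomorphic_on_imp_continuous_on assms)
  show ?thesis unfolding fock_density_def[abs_def] by measurable
qed

lemma fock_space_iff:
  "f \<in> fock_space \<alpha> p \<longleftrightarrow> f holomorphic_on UNIV \<and> integrable lborel (\<lambda>z. fock_density \<alpha> f z powr p)"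
  unfolding fock_space_def fock_weighted_eq[abs_def] by simp

lemma fock_spaceI:
  assumes "f holomorphic_on UNIV" "integrable lborel H" "\<And>z. fock_density \<alpha> f z powr p \<le> H z"
  shows "f \<in> fock_space \<alpha> p"
  unfolding fock_space_iff
proof (intro conjI assms(1) Bochner_Integration.integrable_bound[OF assms(2)])
  show "(\<lambda>z. fock_density \<alpha> f z powr p) \<in> borel_measurable lborel"
    using fock_density_measurable[OF assms(1), of \<alpha>] by measurable
qed (auto intro: order_trans[OF assms(3) abs_ge_self])

lemma fock_norm_nonneg [simp]: "0 \<le> fock_norm \<alpha> p f"
  by (simp add: fock_norm_def)

lemma fock_norm_powr:
  assumes "0 < p"
  shows "fock_norm \<alpha> p f powr p = (LINT z|lborel. fock_density \<alpha> f z powr p)"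
  using assms by (simp add: fock_norm_def fock_weighted_eq powr_powr)

lemma fock_norm_powr_le:
  assumes "0 < p" "integrable lborel H" "\<And>z. fock_density \<alpha> f z powr p \<le> H z"
  shows "fock_norm \<alpha> p f powr p \<le> (LINT z|lborel. H z)"
  unfolding fock_norm_powr[OF assms(1)]
  by (rule integral_mono') (use assms order_trans[OF powr_ge_zero assms(3)] in auto)

lemma fock_space_scale:
  assumes "f \<in> fock_space \<alpha> p"
  shows "(\<lambda>z. c * f z) \<in> fock_space \<alpha> p"
  using assms by (auto simp: fock_space_iff fock_density_scale powr_mult intro!: holomorphic_intros)

lemma fock_norm_scale:
  assumes "0 < p"
  shows "fock_norm \<alpha> p (\<lambda>z. c * f z) = cmod c * fock_norm \<alpha> p f"
  using assms by (simp add: fock_norm_def fock_weighted_eq fock_density_scale powr_mult powr_powr)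

lemma fock_space_add:
  assumes "0 < p" "f \<in> fock_space \<alpha> p" "h \<in> fock_space \<alpha> p"
  shows "(\<lambda>z. f z + h z) \<in> fock_space \<alpha> p"
proof (rule fock_spaceI)
  show "(\<lambda>z. f z + h z) holomorphic_on UNIV"
    using assms by (auto simp: fock_space_iff intro!: holomorphic_intros)
  show "integrable lborel (\<lambda>z. 2 powr p * (fock_density \<alpha> f z powr p + fock_density \<alpha> h z powr p))"
    using assms by (auto simp: fock_space_iff)
  fix z
  let ?a = "fock_density \<alpha> f z" and ?b = "fock_density \<alpha> h z"
  have "fock_density \<alpha> (\<lambda>z. f z + h z) z powr p \<le> (2 * max ?a ?b) powr p"
    using fock_density_add[of \<alpha> f h z] assms by (intro powr_mono2) auto
  also have "\<dots> = 2 powr p * max ?a ?b powr p"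
    by (simp add: powr_mult)
  also have "\<dots> \<le> 2 powr p * (?a powr p + ?b powr p)"
    by (intro mult_left_mono) (auto simp: max_def)
  finally show "fock_density \<alpha> (\<lambda>z. f z + h z) z powr p \<le> 2 powr p * (?a powr p + ?b powr p)" .
qed

lemma fock_space_zero: "(\<lambda>z. 0) \<in> fock_space \<alpha> p"
  by (simp add: fock_space_iff fock_density_def)

lemma fock_space_sum:
  assumes "0 < p" "finite I" "\<And>i. i \<in> I \<Longrightarrow> f i \<in> fock_space \<alpha> p"
  shows "(\<lambda>z. \<Sum>i\<in>I. c i * f i z) \<in> fock_space \<alpha> p"
  using assms(2,3)
  by (induction I rule: finite_induct)
    (auto simp: fock_space_zero intro!: fock_space_add assms(1) fock_space_scale)

lemma linear_operator_sum:
  assumes T: "linear_operator (fock_space \<alpha> p) Y T" and "0 < p" "finite I"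
    and f: "\<And>i. i \<in> I \<Longrightarrow> f i \<in> fock_space \<alpha> p"
  shows "T (\<lambda>z. \<Sum>i\<in>I. c i * f i z) = (\<lambda>w. \<Sum>i\<in>I. c i * T (f i) w)"
  using assms(3) f
proof (induction I rule: finite_induct)
  case empty
  have "T (\<lambda>z. c * h z) = (\<lambda>w. c * T h w)" if "h \<in> fock_space \<alpha> p" for c h
    using T that unfolding linear_operator_def by blast
  from this[OF fock_space_zero, of 0] show ?case by simp
next
  case (insert i I)
  have "T (\<lambda>z. c i * f i z + (\<Sum>j\<in>I. c j * f j z))
      = (\<lambda>w. T (\<lambda>z. c i * f i z) w + T (\<lambda>z. \<Sum>j\<in>I. c j * f j z) w)"
    using T insert assms(2) unfolding linear_operator_def
    by (auto simp: fock_space_scale fock_space_sum)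
  moreover have "T (\<lambda>z. c i * f i z) = (\<lambda>w. c i * T (f i) w)"
    using T insert unfolding linear_operator_def by blast
  ultimately show ?case using insert by simp
qed

lemma dual_ball_sum:
  assumes \<phi>: "\<phi> \<in> dual_ball (fock_space \<alpha> p) N" and "0 < p" "finite I"
    and f: "\<And>i. i \<in> I \<Longrightarrow> f i \<in> fock_space \<alpha> p"
  shows "\<phi> (\<lambda>z. \<Sum>i\<in>I. c i * f i z) = (\<Sum>i\<in>I. c i * \<phi> (f i))"
  using assms(3) f
proof (induction I rule: finite_induct)
  case empty
  have "\<phi> (\<lambda>z. c * h z) = c * \<phi> h" if "h \<in> fock_space \<alpha> p" for c h
    using \<phi> that unfolding dual_ball_def by blast
  from this[OF fock_space_zero, of 0] show ?case by simp
next
  case (insert i I)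
  have "\<phi> (\<lambda>z. c i * f i z + (\<Sum>j\<in>I. c j * f j z))
      = \<phi> (\<lambda>z. c i * f i z) + \<phi> (\<lambda>z. \<Sum>j\<in>I. c j * f j z)"
    using \<phi> insert assms(2) unfolding dual_ball_def
    by (auto simp: fock_space_scale fock_space_sum)
  moreover have "\<phi> (\<lambda>z. c i * f i z) = c i * \<phi> (f i)"
    using \<phi> insert unfolding dual_ball_def by blast
  ultimately show ?case using insert by simp
qed

section \<open>Bounded point evaluation\<close>

lemma cmod_diff_power2: "(cmod (z - w))\<^sup>2 = (cmod z)\<^sup>2 + (cmod w)\<^sup>2 - 2 * Re (z * cnj w)"
  unfolding cmod_power2 by (simp add: power2_eq_square algebra_simps)

text \<open>Completing the square: multiplication by this zero-free entire function recentres the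
  Gaussian weight from 0 to \<open>w\<close>, up to a factor that depends on \<open>w\<close>
  only.\<close>

lemma cmod_exp_density:
  "cmod (exp (- of_real \<alpha> * z * cnj w)) = exp (- (\<alpha> / 2) * (cmod z)\<^sup>2) * exp (\<alpha> / 2 * (cmod (z - w))\<^sup>2) * exp (- (\<alpha> / 2) * (cmod w)\<^sup>2)"
proof -
  have "- \<alpha> * Re (z * cnj w) = - (\<alpha> / 2) * (cmod z)\<^sup>2 + \<alpha> / 2 * (cmod (z - w))\<^sup>2 + - (\<alpha> / 2) * (cmod w)\<^sup>2"
    unfolding cmod_diff_power2 by (simp add: field_simps)
  moreover have "Re (- of_real \<alpha> * z * cnj w) = - \<alpha> * Re (z * cnj w)"
    by (simp add: algebra_simps)
  ultimately show ?thesis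
    by (simp only: norm_exp_eq_Re exp_add[symmetric])
qed

text \<open>The weight is not holomorphic, so the mean value estimate is applied to the entire
  function \<open>h z = f z * exp (- of_real \<alpha> * z * cnj w)\<close>. On the ball of radius
  3/2 around \<open>w\<close> its modulus is the density of \<open>f\<close> times
  \<open>exp (- (\<alpha> / 2) * (cmod w)\<^sup>2)\<close>, which cancels at the end, and a factor
  between 1 and \<open>exp (9 * \<alpha> / 8)\<close>. Hoelder on that ball passes to the
  \<open>p\<close>-norm, uniformly in \<open>w\<close>.\<close>

lemma fock_eval:
  fixes \<alpha> p :: real
  assumes "0 < \<alpha>" "1 \<le> p"
  obtains C where "0 < C"
    "\<And>f w. f \<in> fock_space \<alpha> p \<Longrightarrow> fock_density \<alpha> f w \<le> C * fock_norm \<alpha> p f"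
proof -
  define c where "c = measure lborel (ball (0::complex) (1/2))"
  define M where "M = measure lborel (ball (0::complex) (3/2))"
  have c: "0 < c"
    using content_ball_pos[of "1/2" "0::complex"] by (simp add: c_def)
  have M: "0 \<le> M" by (simp add: M_def)
  have "fock_density \<alpha> f w \<le> (2 * exp (9 * \<alpha> / 8) * (M + 1) / c) * fock_norm \<alpha> p f"
    if f: "f \<in> fock_space \<alpha> p" for f w
  proof -
    let ?D = "fock_density \<alpha> f" and ?B = "ball w (3/2)"
    define h where "h z = f z * exp (- of_real \<alpha> * z * cnj w)" for z
    have holf: "f holomorphic_on UNIV" and intf: "integrable lborel (\<lambda>z. ?D z powr p)"
      using f by (auto simp: fock_space_iff)
    note [measurable] = fock_density_measurable[OF holf]
    have contf: "continuous_on UNIV f"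
      using holf by (rule holomorphic_on_imp_continuous_on)
    have intB: "integrable lborel (\<lambda>z. indicator ?B z * ?D z)"
    proof (rule Bochner_Integration.integrable_bound)
      show "integrable lborel (\<lambda>z. indicator (cball w (3/2)) z *\<^sub>R ?D z)"
        unfolding fock_density_def
        by (intro borel_integrable_compact continuous_intros continuous_on_subset[OF contf]) auto
    qed (auto simp: indicator_def)
    have Mw: "(LINT z|lborel. indicator ?B z) = M"
      by (simp add: M_def measure_def emeasure_ball)
    have finB: "emeasure lborel ?B < \<infinity>"
      by (simp add: emeasure_ball ennreal_mult_less_top)
    have I: "(LINT z|lborel. indicator ?B z * ?D z) \<le> (M + 1) * fock_norm \<alpha> p f"
    proof -
      have "(LINT z|lborel. indicator ?B z * ?D z)
          \<le> (M + 1) * (LINT z|lborel. ?D z powr p) powr (1 / p)"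
      proof (rule le_of_split)
        fix u :: real assume u: "0 < u"
        have "(LINT z|lborel. indicator ?B z * ?D z)
            \<le> (LINT z|lborel. u * indicator ?B z + u powr (1 - p) * ?D z powr p)"
        proof (rule integral_mono)
          show "integrable lborel (\<lambda>z. u * indicator ?B z + u powr (1 - p) * ?D z powr p)"
            using intf finB by (intro Bochner_Integration.integrable_add integrable_mult_right) auto
          show "indicator ?B z * ?D z \<le> u * indicator ?B z + u powr (1 - p) * ?D z powr p" for z
            using le_split_powr[of "?D z" u p] u assms by (auto simp: indicator_def)
        qed (use intB in auto)
        also have "\<dots> = u * M + u powr (1 - p) * (LINT z|lborel. ?D z powr p)"
          using intf finB Mw
          by (subst Bochner_Integration.integral_add) (auto intro!: integrable_mult_right)
        finally show "(LINT z|lborel. indicator ?B z * ?D z)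
            \<le> u * M + u powr (1 - p) * (LINT z|lborel. ?D z powr p)" .
      qed (use assms M in auto)
      then show ?thesis by (simp add: fock_norm_def fock_weighted_eq)
    qed
    have "h holomorphic_on UNIV"
      unfolding h_def by (intro holomorphic_intros holf)
    then have "cmod (h w) * c \<le> 2 * (LINT z|lborel. indicator ?B z * cmod (h z))"
      unfolding c_def by (rule cmod_le_integral_ball)
    also have "(LINT z|lborel. indicator ?B z * cmod (h z))
        \<le> (LINT z|lborel. exp (9 * \<alpha> / 8) * exp (- (\<alpha> / 2) * (cmod w)\<^sup>2) * (indicator ?B z * ?D z))"
    proof (rule integral_mono')
      fix z
      have "cmod (h z) \<le> exp (9 * \<alpha> / 8) * exp (- (\<alpha> / 2) * (cmod w)\<^sup>2) * ?D z" if "z \<in> ?B"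
      proof -
        have "(cmod (z - w))\<^sup>2 \<le> (3/2)\<^sup>2"
          using that by (intro power_mono) (auto simp: dist_norm norm_minus_commute)
        then have "\<alpha> / 2 * (cmod (z - w))\<^sup>2 \<le> 9 * \<alpha> / 8"
          using assms by (simp add: power2_eq_square field_simps)
        then have "?D z * exp (- (\<alpha> / 2) * (cmod w)\<^sup>2) * exp (\<alpha> / 2 * (cmod (z - w))\<^sup>2)
            \<le> ?D z * exp (- (\<alpha> / 2) * (cmod w)\<^sup>2) * exp (9 * \<alpha> / 8)"
          by (intro mult_left_mono) auto
        then show ?thesis
          unfolding h_def norm_mult cmod_exp_density fock_density_def by (simp add: mult_ac)
      qed
      then show "indicator ?B z * cmod (h z)
          \<le> exp (9 * \<alpha> / 8) * exp (- (\<alpha> / 2) * (cmod w)\<^sup>2) * (indicator ?B z * ?D z)"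
        by (auto simp: indicator_def)
    qed (use intB in auto)
    also have "\<dots> = exp (9 * \<alpha> / 8) * exp (- (\<alpha> / 2) * (cmod w)\<^sup>2) * (LINT z|lborel. indicator ?B z * ?D z)"
      by simp
    also have "\<dots> \<le> exp (9 * \<alpha> / 8) * exp (- (\<alpha> / 2) * (cmod w)\<^sup>2) * ((M + 1) * fock_norm \<alpha> p f)"
      by (intro mult_left_mono I) auto
    finally have "cmod (h w) * c \<le> 2 * (exp (9 * \<alpha> / 8) * exp (- (\<alpha> / 2) * (cmod w)\<^sup>2) * ((M + 1) * fock_norm \<alpha> p f))"
      by simp
    moreover have "cmod (h w) = ?D w * exp (- (\<alpha> / 2) * (cmod w)\<^sup>2)"
      unfolding h_def norm_mult cmod_exp_density fock_density_def by simp
    ultimately have "exp (- (\<alpha> / 2) * (cmod w)\<^sup>2) * (?D w * c)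
        \<le> exp (- (\<alpha> / 2) * (cmod w)\<^sup>2) * (2 * (exp (9 * \<alpha> / 8) * ((M + 1) * fock_norm \<alpha> p f)))"
      by (simp only: mult_ac)
    then have "?D w * c \<le> 2 * (exp (9 * \<alpha> / 8) * ((M + 1) * fock_norm \<alpha> p f))"
      by (subst (asm) mult_le_cancel_left_pos) auto
    then show ?thesis using c by (simp add: field_simps)
  qed
  then show ?thesis
    using c M by (intro that[of "2 * exp (9 * \<alpha> / 8) * (M + 1) / c"]) (auto simp: divide_simps)
qed

subsection \<open>Summing operators and the Volterra operator\<close>

text \<open>A form convenient for testing: arbitrary finite index sets, no roots and no supremum,
  only a common bound \<open>B\<close> on the weak sums. The new constant is
  \<open>C powr r + 1\<close>, where the 1 ensures positivity. The index type is fixed by the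
  caller, since an obtained fact is monomorphic.\<close>

lemma r_summingD:
  assumes summing: "r_summing r X NX Y NY T" and "1 \<le> r" and NX: "\<And>f. f \<in> X \<Longrightarrow> 0 \<le> NX f"
  obtains C where "0 < C"
    "\<And>(I :: 'i set) x B. finite I \<Longrightarrow> (\<And>i. i \<in> I \<Longrightarrow> x i \<in> X) \<Longrightarrow>
      (\<And>\<phi>. \<phi> \<in> dual_ball X NX \<Longrightarrow> (\<Sum>i\<in>I. cmod (\<phi> (x i)) powr r) \<le> B) \<Longrightarrow>
      (\<Sum>i\<in>I. NY (T (x i)) powr r) \<le> C * B"
proof -
  obtain C where C: "0 \<le> C" and le: "\<And>(n::nat) x. (\<And>j. j \<in> {1..n} \<Longrightarrow> x j \<in> X) \<Longrightarrow>
      (\<Sum>j=1..n. NY (T (x j)) powr r) powr (1 / r)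
        \<le> C * (SUP \<phi>\<in>dual_ball X NX. (\<Sum>j=1..n. cmod (\<phi> (x j)) powr r) powr (1 / r))"
    using summing unfolding r_summing_def by blast
  have ne: "dual_ball X NX \<noteq> {}"
    using NX by (rule dual_ball_nonempty)
  have "(\<Sum>i\<in>I. NY (T (x i)) powr r) \<le> (C powr r + 1) * B"
    if I: "finite I" and x: "\<And>i. i \<in> I \<Longrightarrow> x i \<in> X"
      and B: "\<And>\<phi>. \<phi> \<in> dual_ball X NX \<Longrightarrow> (\<Sum>i\<in>I. cmod (\<phi> (x i)) powr r) \<le> B"
    for I :: "'i set" and x B
  proof -
    obtain e where e: "bij_betw e {1..card I} I"
      using ex_bij_betw_nat_finite_1[OF I] by blast
    have reindex: "(\<Sum>j=1..card I. F (e j)) = (\<Sum>i\<in>I. F i)" for F :: "'i \<Rightarrow> real"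
      using e by (rule sum.reindex_bij_betw)
    obtain \<phi> where "\<phi> \<in> dual_ball X NX" using ne by blast
    from B[OF this] have B0: "0 \<le> B"
      by (rule order_trans[rotated]) (auto intro: sum_nonneg)
    have "(\<Sum>i\<in>I. NY (T (x i)) powr r) powr (1 / r)
        \<le> C * (SUP \<phi>\<in>dual_ball X NX. (\<Sum>i\<in>I. cmod (\<phi> (x i)) powr r) powr (1 / r))"
    proof -
      have "(\<Sum>j=1..card I. NY (T (x (e j))) powr r) = (\<Sum>i\<in>I. NY (T (x i)) powr r)"
        by (rule reindex)
      moreover have "(\<Sum>j=1..card I. cmod (\<phi> (x (e j))) powr r) = (\<Sum>i\<in>I. cmod (\<phi> (x i)) powr r)" for \<phi>
        by (rule reindex)
      ultimately show ?thesis
        using le[of "card I" "\<lambda>j. x (e j)"] x bij_betwE[OF e] by (simp only:)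
    qed
    also have "\<dots> \<le> C * B powr (1 / r)"
      using B assms(2) by (intro mult_left_mono C cSUP_least ne powr_mono2 sum_nonneg) auto
    finally have "((\<Sum>i\<in>I. NY (T (x i)) powr r) powr (1 / r)) powr r \<le> (C * B powr (1 / r)) powr r"
      using assms(2) by (intro powr_mono2) auto
    then have "(\<Sum>i\<in>I. NY (T (x i)) powr r) \<le> C powr r * B"
      using assms(2) B0 C by (simp add: powr_powr powr_mult sum_nonneg)
    then show ?thesis using B0 by (simp add: algebra_simps)
  qed
  then show ?thesis
    by (intro that[of "C powr r + 1"]) (auto intro: add_nonneg_pos)
qed

text \<open>The hypothesis is applied with \<open>B = S powr r\<close>, where \<open>S\<close> is
  the supremum; each functional stays below \<open>S\<close> because the family is bounded above, by
  \<open>dual_ball_bdd_above\<close>.\<close>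

lemma r_summingI:
  assumes "linear_operator X Y T" and r: "1 \<le> r" and NX: "\<And>f. f \<in> X \<Longrightarrow> 0 \<le> NX f" and C: "0 \<le> C"
    and le: "\<And>(n::nat) x B. (\<And>j. j \<in> {1..n} \<Longrightarrow> x j \<in> X) \<Longrightarrow>
      (\<And>\<phi>. \<phi> \<in> dual_ball X NX \<Longrightarrow> (\<Sum>j=1..n. cmod (\<phi> (x j)) powr r) \<le> B) \<Longrightarrow>
      (\<Sum>j=1..n. NY (T (x j)) powr r) \<le> C * B"
  shows "r_summing r X NX Y NY T"
proof -
  have "(\<Sum>j=1..n. NY (T (x j)) powr r) powr (1 / r)
      \<le> C powr (1 / r) * (SUP \<phi>\<in>dual_ball X NX. (\<Sum>j=1..n. cmod (\<phi> (x j)) powr r) powr (1 / r))"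
    if x: "\<And>j. j \<in> {1..n} \<Longrightarrow> x j \<in> X" for n :: nat and x
  proof -
    define S where "S = (SUP \<phi>\<in>dual_ball X NX. (\<Sum>j=1..n. cmod (\<phi> (x j)) powr r) powr (1 / r))"
    have upper: "(\<Sum>j=1..n. cmod (\<phi> (x j)) powr r) powr (1 / r) \<le> S"
      if "\<phi> \<in> dual_ball X NX" for \<phi>
      unfolding S_def using x by (intro cSUP_upper that dual_ball_bdd_above r) auto
    obtain \<phi> where "\<phi> \<in> dual_ball X NX"
      using dual_ball_nonempty NX by blast
    then have S: "0 \<le> S"
      by (rule order_trans[OF powr_ge_zero upper])
    have "(\<Sum>j=1..n. NY (T (x j)) powr r) \<le> C * S powr r"
    proof (rule le)
      fix \<phi> assume "\<phi> \<in> dual_ball X NX"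
      then have "((\<Sum>j=1..n. cmod (\<phi> (x j)) powr r) powr (1 / r)) powr r \<le> S powr r"
        using r by (intro powr_mono2 upper) auto
      then show "(\<Sum>j=1..n. cmod (\<phi> (x j)) powr r) \<le> S powr r"
        using r by (simp add: powr_powr sum_nonneg)
    qed (use x in auto)
    then have "(\<Sum>j=1..n. NY (T (x j)) powr r) powr (1 / r) \<le> (C * S powr r) powr (1 / r)"
      using r by (intro powr_mono2 sum_nonneg) auto
    also have "\<dots> = C powr (1 / r) * S"
      using r S C by (simp add: powr_mult powr_powr)
    finally show ?thesis by (simp add: S_def)
  qed
  then show ?thesis
    unfolding r_summing_def using assms(1) powr_ge_zero by blast
qed

text \<open>
  Apply \<open>r\<close>-summability to the vectors \<open>x j\<close> rescaled by \<open>NY (T (x j)) powr (q / r - 1)\<close>.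
\<close>

lemma r_summing_mono:
  assumes summing: "r_summing r X NX Y NY T" and r: "1 \<le> r" "r \<le> q"
    and NX: "\<And>f. f \<in> X \<Longrightarrow> 0 \<le> NX f" and NY: "\<And>f. 0 \<le> NY f"
    and scaleX: "\<And>c f. f \<in> X \<Longrightarrow> (\<lambda>z. c * f z) \<in> X"
    and scaleY: "\<And>c f. NY (\<lambda>z. c * f z) = cmod c * NY f"
  shows "r_summing q X NX Y NY T"
proof (rule r_summingD[where 'i = nat, OF summing r(1) NX])
  fix C :: real
  assume C: "0 < C" and le: "\<And>(I :: nat set) x B. finite I \<Longrightarrow> (\<And>i. i \<in> I \<Longrightarrow> x i \<in> X) \<Longrightarrow>
      (\<And>\<phi>. \<phi> \<in> dual_ball X NX \<Longrightarrow> (\<Sum>i\<in>I. cmod (\<phi> (x i)) powr r) \<le> B) \<Longrightarrow>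
      (\<Sum>i\<in>I. NY (T (x i)) powr r) \<le> C * B"
  have lin: "linear_operator X Y T"
    using summing by (simp add: r_summing_def)
  \<comment> \<open>With this \<open>u\<close> the term \<open>C * u * S\<close> below equals
    \<open>S / 2\<close> and is absorbed into the left side.\<close>
  define u where "u = 1 / (2 * C)"
  have u: "0 < u" using C by (simp add: u_def)
  show ?thesis
  proof (rule r_summingI[OF lin _ NX])
    show "0 \<le> 2 * C * u powr (1 - q / r)" using C by simp
    fix n :: nat and x B
    assume x: "\<And>j. j \<in> {1..n} \<Longrightarrow> x j \<in> X"
      and B: "\<And>\<phi>. \<phi> \<in> dual_ball X NX \<Longrightarrow> (\<Sum>j=1..n. cmod (\<phi> (x j)) powr q) \<le> B"
    define y where "y j = NY (T (x j))" for j
    have y: "0 \<le> y j" for j by (simp add: y_def NY)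
    define \<mu> where "\<mu> j = (\<lambda>z. of_real (y j powr (q / r - 1)) * x j z)" for j
    define S where "S = (\<Sum>j=1..n. y j powr q)"
    \<comment> \<open>The rescaling is chosen for this identity: the strong \<open>r\<close>-sum of
      the new vectors is the strong \<open>q\<close>-sum \<open>S\<close> of the original
      ones.\<close>
    have "NY (T (\<mu> j)) powr r = y j powr q" if "j \<in> {1..n}" for j
    proof -
      have "T (\<mu> j) = (\<lambda>w. of_real (y j powr (q / r - 1)) * T (x j) w)"
        using lin x[OF that] unfolding linear_operator_def \<mu>_def by blast
      then have "NY (T (\<mu> j)) = y j powr (q / r - 1) * y j"
        by (simp add: scaleY y_def)
      also have "\<dots> = y j powr (q / r)"
        using powr_mult_base[OF y[of j], of "q / r - 1"] by (simp add: mult.commute)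
      finally show ?thesis using r by (simp add: powr_powr)
    qed
    then have "S = (\<Sum>j=1..n. NY (T (\<mu> j)) powr r)"
      by (simp add: S_def)
    also have "\<dots> \<le> C * (u * S + u powr (1 - q / r) * B)"
    proof (rule le)
      fix \<phi> assume \<phi>: "\<phi> \<in> dual_ball X NX"
      have "cmod (\<phi> (\<mu> j)) powr r \<le> u * y j powr q + u powr (1 - q / r) * cmod (\<phi> (x j)) powr q"
        if "j \<in> {1..n}" for j
      \<comment> \<open>As \<open>0 powr a = 0\<close> for every exponent, including 0, the rescaled
        vector vanishes if \<open>y j = 0\<close>. Otherwise \<open>y j powr q\<close> is factored
        out and the ratio \<open>t\<close> is split with exponent \<open>q / r\<close>.\<close>
      proof (cases "y j = 0")
        case True
        have "\<phi> (\<mu> j) = of_real (y j powr (q / r - 1)) * \<phi> (x j)"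
          using \<phi> x[OF that] unfolding dual_ball_def \<mu>_def by blast
        then show ?thesis using True by simp
      next
        case False
        then have yj: "0 < y j" using y[of j] by simp
        define t where "t = cmod (\<phi> (x j)) powr r / y j powr r"
        have "\<phi> (\<mu> j) = of_real (y j powr (q / r - 1)) * \<phi> (x j)"
          using \<phi> x[OF that] unfolding dual_ball_def \<mu>_def by blast
        then have "cmod (\<phi> (\<mu> j)) powr r = (y j powr (q / r - 1)) powr r * cmod (\<phi> (x j)) powr r"
          by (simp add: norm_mult powr_mult)
        also have "(y j powr (q / r - 1)) powr r = y j powr q / y j powr r"
        proof -
          have "(q / r - 1) * r = q - r" using r by (simp add: left_diff_distrib)
          then show ?thesis unfolding powr_powr by (simp only:) (rule powr_diff)
        qed
        finally have "cmod (\<phi> (\<mu> j)) powr r = y j powr q * t"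
          by (simp add: t_def)
        also have "\<dots> \<le> y j powr q * (u + u powr (1 - q / r) * t powr (q / r))"
          using u r by (intro mult_left_mono le_split_powr) (auto simp: t_def)
        also have "t powr (q / r) = cmod (\<phi> (x j)) powr q / y j powr q"
          using r by (simp add: t_def powr_divide powr_powr)
        finally show ?thesis using yj by (simp add: distrib_left mult.commute)
      qed
      then have "(\<Sum>j=1..n. cmod (\<phi> (\<mu> j)) powr r)
          \<le> (\<Sum>j=1..n. u * y j powr q + u powr (1 - q / r) * cmod (\<phi> (x j)) powr q)"
        by (intro sum_mono) auto
      also have "\<dots> = u * S + u powr (1 - q / r) * (\<Sum>j=1..n. cmod (\<phi> (x j)) powr q)"
        by (simp add: S_def sum.distrib sum_distrib_left)
      also have "\<dots> \<le> u * S + u powr (1 - q / r) * B"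
        using B[OF \<phi>] by (intro add_left_mono mult_left_mono) auto
      finally show "(\<Sum>j=1..n. cmod (\<phi> (\<mu> j)) powr r) \<le> u * S + u powr (1 - q / r) * B" .
    qed (use x in \<open>auto simp: \<mu>_def intro: scaleX\<close>)
    also have "\<dots> = S / 2 + C * u powr (1 - q / r) * B"
      using C by (simp add: u_def distrib_left)
    finally have "S \<le> 2 * C * u powr (1 - q / r) * B" by simp
    then show "(\<Sum>j=1..n. NY (T (x j)) powr q) \<le> 2 * C * u powr (1 - q / r) * B"
      by (simp add: S_def y_def)
  qed (use r in auto)
qed

lemma volterra_r_summing_mono:
  assumes "volterra_r_summing r \<alpha> p g" "1 \<le> r" "r \<le> q" "0 < p"
  shows "volterra_r_summing q \<alpha> p g"
  using assms unfolding volterra_r_summing_def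
  by (intro r_summing_mono[of r _ _ _ _ _ q]) (auto simp: fock_space_scale fock_norm_scale)

section \<open>Elementary properties of the Volterra operator\<close>

lemma volterra_contour_integrable:
  assumes "f holomorphic_on UNIV" "g holomorphic_on UNIV"
  shows "(\<lambda>\<zeta>. f \<zeta> * deriv g \<zeta>) contour_integrable_on linepath 0 z"
proof -
  have "(\<lambda>\<zeta>. f \<zeta> * deriv g \<zeta>) holomorphic_on UNIV"
    using assms by (intro holomorphic_intros) auto
  then show ?thesis
    by (intro contour_integrable_continuous_linepath holomorphic_on_imp_continuous_on)
      (rule holomorphic_on_subset, auto)
qed

lemma volterra_eq_primitive:
  assumes "\<And>z. (F has_field_derivative f z * deriv g z) (at z)"
  shows "volterra g f z = F z - F 0"
  unfolding volterra_def
  using contour_integral_primitive[of UNIV F "\<lambda>\<zeta>. f \<zeta> * deriv g \<zeta>" "linepath 0 z"] assms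
  by (intro contour_integral_unique) auto

lemma volterra_has_field_derivative:
  assumes "f holomorphic_on UNIV" "g holomorphic_on UNIV"
  shows "(volterra g f has_field_derivative f z * deriv g z) (at z)"
proof -
  have "(\<lambda>\<zeta>. f \<zeta> * deriv g \<zeta>) holomorphic_on UNIV"
    using assms by (intro holomorphic_intros) auto
  then obtain F where F: "\<And>z. (F has_field_derivative f z * deriv g z) (at z)"
    using holomorphic_convex_primitive'[of UNIV "\<lambda>\<zeta>. f \<zeta> * deriv g \<zeta>"] by auto
  have "volterra g f = (\<lambda>z. F z - F 0)"
    using F by (intro ext volterra_eq_primitive)
  then show ?thesis
    using F by (auto intro!: derivative_eq_intros)
qed

lemma volterra_holomorphic:
  assumes "f holomorphic_on UNIV" "g holomorphic_on UNIV"
  shows "volterra g f holomorphic_on UNIV"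
  using volterra_has_field_derivative[OF assms]
  by (auto simp: holomorphic_on_def field_differentiable_def)

lemma volterra_add:
  assumes "f holomorphic_on UNIV" "h holomorphic_on UNIV" "g holomorphic_on UNIV"
  shows "volterra g (\<lambda>z. f z + h z) = (\<lambda>w. volterra g f w + volterra g h w)"
  unfolding volterra_def distrib_right
  by (intro ext contour_integral_add volterra_contour_integrable assms)

lemma volterra_scale:
  assumes "f holomorphic_on UNIV" "g holomorphic_on UNIV"
  shows "volterra g (\<lambda>z. c * f z) = (\<lambda>w. c * volterra g f w)"
  unfolding volterra_def mult.assoc
  by (intro ext contour_integral_lmul volterra_contour_integrable assms)

lemma volterra_linear_operator:
  assumes "g holomorphic_on UNIV" "\<And>f. f \<in> fock_space \<alpha> p \<Longrightarrow> volterra g f \<in> fock_space \<alpha> p"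
  shows "linear_operator (fock_space \<alpha> p) (fock_space \<alpha> p) (volterra g)"
  using assms by (auto simp: linear_operator_def fock_space_iff volterra_add volterra_scale)

section \<open>Summability for symbols with constant derivative\<close>

text \<open>On the ray from 0 to \<open>z\<close> the integrand has Gaussian growth in
  \<open>t * R\<close>. Since \<open>t\<^sup>2 \<le> t\<close> on the unit interval, the exponent
  may be made linear in \<open>t\<close>, and the resulting integral is at most
  \<open>2 / (\<alpha> * R)\<close> times the Gaussian at the endpoint. This gains one power of
  \<open>R\<close>; near the origin the length of the segment suffices.\<close>

lemma volterra_affine_bound:
  fixes \<alpha> A :: real
  assumes \<alpha>: "0 < \<alpha>" and f: "f holomorphic_on UNIV" and g: "\<And>z. deriv g z = a"
    and A: "\<And>z. fock_density \<alpha> f z \<le> A"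
  shows "fock_density \<alpha> (volterra g f) z \<le> (2 + 4 / \<alpha>) * (cmod a * A) / (1 + cmod z)"
proof -
  define R where "R = cmod z"
  have R: "0 \<le> R" by (simp add: R_def)
  have A0: "0 \<le> A" by (rule order_trans[OF fock_density_nonneg A])
  have f_le: "cmod (f w) \<le> A * exp (\<alpha> / 2 * (cmod w)\<^sup>2)" for w
    using A[of w] by (simp add: fock_density_def exp_minus field_simps)
  have int: "(\<lambda>\<zeta>. f \<zeta> * a) contour_integrable_on linepath 0 z"
    using f by (intro contour_integrable_continuous_linepath continuous_intros
        holomorphic_on_imp_continuous_on) (rule holomorphic_on_subset, auto)
  have "cmod (volterra g f z) \<le> (2 + 4 / \<alpha>) * (cmod a * A) / (1 + R) * exp (\<alpha> / 2 * R\<^sup>2)"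
  proof (cases "R \<le> 1")
    case True
    have "cmod (volterra g f z) \<le> (A * exp (\<alpha> / 2 * R\<^sup>2) * cmod a) * cmod (z - 0)"
      unfolding volterra_def g
    proof (rule contour_integral_bound_linepath[OF int])
      fix x assume "x \<in> closed_segment 0 z"
      then have "cmod x \<le> R"
        using segment_bound(1)[of x 0 z] by (simp add: R_def)
      then have "\<alpha> / 2 * (cmod x)\<^sup>2 \<le> \<alpha> / 2 * R\<^sup>2"
        using \<alpha> by (intro mult_left_mono power_mono) auto
      then have "A * exp (\<alpha> / 2 * (cmod x)\<^sup>2) \<le> A * exp (\<alpha> / 2 * R\<^sup>2)"
        using A0 by (intro mult_left_mono) auto
      then show "cmod (f x * a) \<le> A * exp (\<alpha> / 2 * R\<^sup>2) * cmod a"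
        unfolding norm_mult by (intro mult_right_mono order_trans[OF f_le]) auto
    qed (use A0 in auto)
    also have "\<dots> = R * (cmod a * A * exp (\<alpha> / 2 * R\<^sup>2))"
      by (simp add: R_def)
    \<comment> \<open>The constant serves both cases: 2 covers \<open>R * (1 + R)\<close> for
      \<open>R \<le> 1\<close>, and \<open>4 / \<alpha>\<close> covers
      \<open>2 * (1 + R) / (\<alpha> * R)\<close> for \<open>R > 1\<close>.\<close>
    also have "\<dots> \<le> (2 + 4 / \<alpha>) / (1 + R) * (cmod a * A * exp (\<alpha> / 2 * R\<^sup>2))"
    proof (intro mult_right_mono)
      have "R * (1 + R) \<le> 1 * (1 + 1)"
        using True R by (intro mult_mono) auto
      also have "\<dots> \<le> 2 + 4 / \<alpha>" using \<alpha> by simp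
      finally show "R \<le> (2 + 4 / \<alpha>) / (1 + R)"
        using R by (simp add: pos_le_divide_eq)
    qed (use A0 in auto)
    finally show ?thesis by simp
  next
    case False
    have R1: "1 < R" using False by simp
    define F where "F t = 2 / (\<alpha> * R) * exp (\<alpha> / 2 * R\<^sup>2 * t)" for t
    have F': "((\<lambda>t. cmod a * A * (R * exp (\<alpha> / 2 * R\<^sup>2 * t))) has_integral cmod a * A * (F 1 - F 0)) {0..1}"
    proof (intro has_integral_mult_right fundamental_theorem_of_calculus)
      fix t :: real
      show "(F has_vector_derivative R * exp (\<alpha> / 2 * R\<^sup>2 * t)) (at t within {0..1})"
        unfolding F_def has_real_derivative_iff_has_vector_derivative[symmetric]
      proof -
        have "((\<lambda>t. 2 / (\<alpha> * R) * exp (\<alpha> / 2 * R\<^sup>2 * t)) has_real_derivative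
            2 / (\<alpha> * R) * (exp (\<alpha> / 2 * R\<^sup>2 * t) * (\<alpha> / 2 * R\<^sup>2))) (at t within {0..1})"
          by (rule derivative_eq_intros refl | simp)+
        also have "2 / (\<alpha> * R) * (exp (\<alpha> / 2 * R\<^sup>2 * t) * (\<alpha> / 2 * R\<^sup>2)) = R * exp (\<alpha> / 2 * R\<^sup>2 * t)"
          using R1 \<alpha> by (simp add: power2_eq_square)
        finally show "((\<lambda>t. 2 / (\<alpha> * R) * exp (\<alpha> / 2 * R\<^sup>2 * t)) has_real_derivative
            R * exp (\<alpha> / 2 * R\<^sup>2 * t)) (at t within {0..1})" .
      qed
    qed auto
    have V: "((\<lambda>t. f (linepath 0 z t) * a * (z - 0)) has_integral volterra g f z) {0..1}"
      using has_contour_integral_integral[OF int] unfolding has_contour_integral_linepath volterra_def g .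
    have "cmod (volterra g f z) \<le> cmod a * A * (F 1 - F 0)"
      unfolding integral_unique[OF V, symmetric] integral_unique[OF F', symmetric]
    proof (rule integral_norm_bound_integral)
      fix t :: real assume t: "t \<in> {0..1}"
      have "t\<^sup>2 \<le> t" using t by (simp add: power2_eq_square mult_left_le_one_le)
      then have "\<alpha> / 2 * R\<^sup>2 * t\<^sup>2 \<le> \<alpha> / 2 * R\<^sup>2 * t"
        using \<alpha> by (intro mult_left_mono) auto
      then have "A * exp (\<alpha> / 2 * (cmod (linepath 0 z t))\<^sup>2) \<le> A * exp (\<alpha> / 2 * R\<^sup>2 * t)"
      proof (intro mult_left_mono)
        have "cmod (linepath 0 z t) = t * R"
          using t by (simp add: linepath_def R_def)
        then show "exp (\<alpha> / 2 * (cmod (linepath 0 z t))\<^sup>2) \<le> exp (\<alpha> / 2 * R\<^sup>2 * t)"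
          using \<open>\<alpha> / 2 * R\<^sup>2 * t\<^sup>2 \<le> _\<close> by (simp add: power_mult_distrib mult_ac)
      qed (rule A0)
      then have "cmod (f (linepath 0 z t)) \<le> A * exp (\<alpha> / 2 * R\<^sup>2 * t)"
        by (rule order_trans[OF f_le])
      then have "cmod (f (linepath 0 z t)) * (cmod a * R) \<le> A * exp (\<alpha> / 2 * R\<^sup>2 * t) * (cmod a * R)"
        using R by (intro mult_right_mono) auto
      then show "cmod (f (linepath 0 z t) * a * (z - 0)) \<le> cmod a * A * (R * exp (\<alpha> / 2 * R\<^sup>2 * t))"
        by (simp add: norm_mult R_def mult_ac)
    qed (use V F' in auto)
    also have "\<dots> \<le> cmod a * A * F 1"
      using A0 \<alpha> R by (intro mult_left_mono) (auto simp: F_def)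
    also have "\<dots> \<le> cmod a * A * ((2 + 4 / \<alpha>) / (1 + R) * exp (\<alpha> / 2 * R\<^sup>2))"
    proof -
      have "2 / (\<alpha> * R) \<le> (2 + 4 / \<alpha>) / (1 + R)"
      proof -
        have "2 * (1 + R) / (\<alpha> * R) \<le> 4 * R / (\<alpha> * R)"
          using R1 \<alpha> by (intro divide_right_mono) auto
        also have "\<dots> \<le> 2 + 4 / \<alpha>"
          using R1 \<alpha> by simp
        finally show ?thesis
          using R1 by (simp add: pos_le_divide_eq)
      qed
      then show ?thesis
        unfolding F_def mult_1_right using A0 by (intro mult_left_mono mult_right_mono) auto
    qed
    finally show ?thesis by (simp add: mult_ac)
  qed
  then have "fock_density \<alpha> (volterra g f) z
      \<le> (2 + 4 / \<alpha>) * (cmod a * A) / (1 + R) * exp (\<alpha> / 2 * R\<^sup>2) * exp (- (\<alpha> / 2) * R\<^sup>2)"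
    unfolding fock_density_def R_def by (intro mult_right_mono) auto
  then show ?thesis
    by (simp add: R_def mult.assoc exp_add[symmetric])
qed

text \<open>
  The inclusion of \<open>F\<^sup>r\<close> in \<open>F\<^sup>p\<close>, with the \<open>p\<close>-norm (rather than the \<open>r\<close>-norm) controlling the supremum.
\<close>

lemma fock_norm_embedding:
  fixes C p r :: real
  assumes h: "h \<in> fock_space \<alpha> p" and p: "0 < p" "r \<le> p" and C: "0 \<le> C"
    and eval: "\<And>z. fock_density \<alpha> h z \<le> C * fock_norm \<alpha> p h"
    and int: "integrable lborel (\<lambda>z. fock_density \<alpha> h z powr r)"
  shows "fock_norm \<alpha> p h powr r \<le> C powr (p - r) * (LINT z|lborel. fock_density \<alpha> h z powr r)"
proof (cases "fock_norm \<alpha> p h = 0")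
  case True
  then show ?thesis by (auto intro!: mult_nonneg_nonneg integral_nonneg_AE)
next
  case False
  define m where "m = fock_norm \<alpha> p h"
  have m: "0 < m" using False by (simp add: m_def less_le)
  \<comment> \<open>All but \<open>r\<close> of the \<open>p\<close> powers of the density are
    replaced by the pointwise bound \<open>C * m\<close>; dividing by \<open>m powr (p - r)\<close>
    then leaves the claim.\<close>
  have "m powr p \<le> (LINT z|lborel. (C * m) powr (p - r) * fock_density \<alpha> h z powr r)"
    unfolding m_def
  proof (rule fock_norm_powr_le)
    fix z
    have "fock_density \<alpha> h z powr p = fock_density \<alpha> h z powr (p - r) * fock_density \<alpha> h z powr r"
      by (simp add: powr_add[symmetric])
    also have "\<dots> \<le> (C * fock_norm \<alpha> p h) powr (p - r) * fock_density \<alpha> h z powr r"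
      using p eval by (intro mult_right_mono powr_mono2) auto
    finally show "fock_density \<alpha> h z powr p \<le> (C * fock_norm \<alpha> p h) powr (p - r) * fock_density \<alpha> h z powr r" .
  qed (use p int in auto)
  also have "\<dots> = m powr (p - r) * (C powr (p - r) * (LINT z|lborel. fock_density \<alpha> h z powr r))"
    using C m by (simp add: powr_mult)
  finally have "m powr (p - r) * m powr r \<le> m powr (p - r) * (C powr (p - r) * (LINT z|lborel. fock_density \<alpha> h z powr r))"
    by (simp add: powr_add[symmetric])
  then show ?thesis
    using m by (simp add: m_def)
qed

text \<open>The range \<open>r \<le> p\<close> is that of \<open>fock_norm_embedding\<close>, which
  replaces the \<open>p\<close>-norms of the images by \<open>r\<close>-integrals that can be added
  under the integral sign. At each \<open>z\<close> one test functional controls the sum, with decay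
  \<open>(1 + cmod z) powr (- r)\<close>, integrable because \<open>2 < r\<close>.\<close>

lemma volterra_affine_r_summing:
  fixes \<alpha> p r :: real
  assumes \<alpha>: "0 < \<alpha>" and r: "2 < r" "r \<le> p" and g: "g holomorphic_on UNIV" "\<And>z. deriv g z = a"
  shows "volterra_r_summing r \<alpha> p g"
  unfolding volterra_r_summing_def
proof (rule fock_eval[of \<alpha> p])
  fix C assume C: "0 < C"
    and eval: "\<And>f w. f \<in> fock_space \<alpha> p \<Longrightarrow> fock_density \<alpha> f w \<le> C * fock_norm \<alpha> p f"
  define K where "K = (2 + 4 / \<alpha>) * (cmod a * C) + 1"
  have K: "0 < K" using C \<alpha> by (auto simp: K_def intro!: add_nonneg_pos)
  have bound: "fock_density \<alpha> (volterra g f) z \<le> K * fock_norm \<alpha> p f / (1 + cmod z)"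
    if f: "f \<in> fock_space \<alpha> p" for f z
  proof -
    have "fock_density \<alpha> (volterra g f) z \<le> (2 + 4 / \<alpha>) * (cmod a * (C * fock_norm \<alpha> p f)) / (1 + cmod z)"
      using f by (intro volterra_affine_bound \<alpha> g eval) (auto simp: fock_space_iff)
    also have "\<dots> \<le> K * fock_norm \<alpha> p f / (1 + cmod z)"
      by (intro divide_right_mono) (auto simp: K_def algebra_simps)
    finally show ?thesis .
  qed
  have bound_powr: "fock_density \<alpha> (volterra g f) z powr s \<le> (K * fock_norm \<alpha> p f) powr s * (1 + cmod z) powr (- s)"
    if f: "f \<in> fock_space \<alpha> p" and s: "0 < s" for f z s
  proof -
    have "fock_density \<alpha> (volterra g f) z powr s \<le> (K * fock_norm \<alpha> p f / (1 + cmod z)) powr s"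
      using s by (intro powr_mono2 bound f) auto
    then show ?thesis
      using K by (simp add: powr_divide powr_minus_divide)
  qed
  have hol: "volterra g f holomorphic_on UNIV" if "f \<in> fock_space \<alpha> p" for f
    using that g by (intro volterra_holomorphic) (auto simp: fock_space_iff)
  have mem: "volterra g f \<in> fock_space \<alpha> p" if f: "f \<in> fock_space \<alpha> p" for f
    using r f by (intro fock_spaceI[OF hol _ bound_powr] integrable_mult_right integrable_one_plus_cmod_powr) auto
  have int: "integrable lborel (\<lambda>z. fock_density \<alpha> (volterra g f) z powr r)" if f: "f \<in> fock_space \<alpha> p" for f
  proof -
    have "volterra g f \<in> fock_space \<alpha> r"
      using r f by (intro fock_spaceI[OF hol _ bound_powr] integrable_mult_right integrable_one_plus_cmod_powr) auto
    then show ?thesis by (simp add: fock_space_iff)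
  qed
  define J where "J = (LINT z|lborel. (1 + cmod z) powr (- r))"
  have lin: "linear_operator (fock_space \<alpha> p) (fock_space \<alpha> p) (volterra g)"
    by (intro volterra_linear_operator g mem)
  show "r_summing r (fock_space \<alpha> p) (fock_norm \<alpha> p) (fock_space \<alpha> p) (fock_norm \<alpha> p) (volterra g)"
  proof (rule r_summingI[OF lin])
    show "0 \<le> C powr (p - r) * (K powr r * J)"
      unfolding J_def by (auto intro!: mult_nonneg_nonneg integral_nonneg_AE)
    fix n :: nat and x B
    assume x: "\<And>j. j \<in> {1..n} \<Longrightarrow> x j \<in> fock_space \<alpha> p"
      and B: "\<And>\<phi>. \<phi> \<in> dual_ball (fock_space \<alpha> p) (fock_norm \<alpha> p) \<Longrightarrow> (\<Sum>j=1..n. cmod (\<phi> (x j)) powr r) \<le> B"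
    have pointwise: "(\<Sum>j=1..n. fock_density \<alpha> (volterra g (x j)) z powr r)
        \<le> K powr r * B * (1 + cmod z) powr (- r)" for z
    proof -
      \<comment> \<open>By \<open>bound\<close>, evaluation of the image at \<open>z\<close>, scaled
        by this factor, is a functional of norm at most 1.\<close>
      define \<kappa> where "\<kappa> = (1 + cmod z) / K * exp (- (\<alpha> / 2) * (cmod z)\<^sup>2)"
      define \<phi> where "\<phi> f = of_real \<kappa> * volterra g f z" for f
      have z1: "0 < 1 + cmod z" by (simp add: add_pos_nonneg)
      have \<phi>_eq: "cmod (\<phi> f) = (1 + cmod z) / K * fock_density \<alpha> (volterra g f) z" for f
        unfolding \<phi>_def norm_mult norm_of_real
        using K z1 by (simp add: \<kappa>_def fock_density_def abs_mult)
      have "\<phi> \<in> dual_ball (fock_space \<alpha> p) (fock_norm \<alpha> p)"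
        unfolding dual_ball_def
      proof (intro CollectI conjI ballI allI)
        fix f h assume "f \<in> fock_space \<alpha> p" "h \<in> fock_space \<alpha> p"
        then show "\<phi> (\<lambda>z. f z + h z) = \<phi> f + \<phi> h"
          using lin by (simp add: \<phi>_def linear_operator_def distrib_left)
      next
        fix c f assume "f \<in> fock_space \<alpha> p"
        then show "\<phi> (\<lambda>z. c * f z) = c * \<phi> f"
          using lin by (simp add: \<phi>_def linear_operator_def)
      next
        fix f assume "f \<in> fock_space \<alpha> p"
        from bound[OF this, of z] show "cmod (\<phi> f) \<le> fock_norm \<alpha> p f"
          using K z1 by (simp add: \<phi>_eq field_simps)
      qed
      from B[OF this] have "((1 + cmod z) / K) powr r * (\<Sum>j=1..n. fock_density \<alpha> (volterra g (x j)) z powr r) \<le> B"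
        using K z1 by (simp add: \<phi>_eq powr_mult sum_distrib_left del: times_divide_eq_left)
      then have "K powr r * (1 + cmod z) powr (- r) * (((1 + cmod z) / K) powr r * (\<Sum>j=1..n. fock_density \<alpha> (volterra g (x j)) z powr r))
          \<le> K powr r * (1 + cmod z) powr (- r) * B"
        by (intro mult_left_mono) auto
      moreover have "K powr r * (1 + cmod z) powr (- r) * ((1 + cmod z) / K) powr r = 1"
        using K z1 by (simp add: powr_divide powr_minus)
      ultimately show ?thesis by (simp only: mult.assoc[symmetric] mult_1_left) (simp add: mult_ac)
    qed
    have "(\<Sum>j=1..n. fock_norm \<alpha> p (volterra g (x j)) powr r)
        \<le> (\<Sum>j=1..n. C powr (p - r) * (LINT z|lborel. fock_density \<alpha> (volterra g (x j)) z powr r))"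
      using C r x by (intro sum_mono fock_norm_embedding mem eval int) auto
    also have "\<dots> = C powr (p - r) * (LINT z|lborel. (\<Sum>j=1..n. fock_density \<alpha> (volterra g (x j)) z powr r))"
      using x by (simp add: sum_distrib_left[symmetric] Bochner_Integration.integral_sum int)
    also have "\<dots> \<le> C powr (p - r) * (LINT z|lborel. K powr r * B * (1 + cmod z) powr (- r))"
      using r x pointwise
      by (intro mult_left_mono integral_mono Bochner_Integration.integrable_sum int integrable_mult_right
          integrable_one_plus_cmod_powr) auto
    also have "\<dots> = C powr (p - r) * (K powr r * J) * B"
      by (simp add: J_def)
    finally show "(\<Sum>j=1..n. fock_norm \<alpha> p (volterra g (x j)) powr r) \<le> C powr (p - r) * (K powr r * J) * B" .
  qed (use r in auto)
qed (use \<alpha> r in auto)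

subsection \<open>Kernels at lattice points\<close>

lemma sum_power_abs_int_le:
  fixes \<rho> :: real
  assumes "0 \<le> \<rho>" "\<rho> < 1" "finite F"
  shows "(\<Sum>d\<in>F. \<rho> ^ nat \<bar>d\<bar>) \<le> 2 / (1 - \<rho>)"
proof -
  have geom: "(\<Sum>n\<in>G. \<rho> ^ n) \<le> 1 / (1 - \<rho>)" if "finite G" for G
    using sum_le_suminf[OF summable_geometric that, of \<rho>] suminf_geometric[of \<rho>] assms by simp
  have "(\<Sum>d\<in>F. \<rho> ^ nat \<bar>d\<bar>) = (\<Sum>d\<in>F \<inter> {0..}. \<rho> ^ nat \<bar>d\<bar>) + (\<Sum>d\<in>F \<inter> {..<0}. \<rho> ^ nat \<bar>d\<bar>)"
    using assms by (subst sum.union_disjoint[symmetric]) (auto intro!: sum.cong)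
  also have "(\<Sum>d\<in>F \<inter> {0..}. \<rho> ^ nat \<bar>d\<bar>) = (\<Sum>n\<in>nat ` (F \<inter> {0..}). \<rho> ^ n)"
    by (subst sum.reindex) (auto simp: inj_on_def)
  also have "(\<Sum>d\<in>F \<inter> {..<0}. \<rho> ^ nat \<bar>d\<bar>) = (\<Sum>n\<in>(\<lambda>d. nat (- d)) ` (F \<inter> {..<0}). \<rho> ^ n)"
    by (subst sum.reindex) (auto simp: inj_on_def)
  also have "(\<Sum>n\<in>nat ` (F \<inter> {0..}). \<rho> ^ n) + (\<Sum>n\<in>(\<lambda>d. nat (- d)) ` (F \<inter> {..<0}). \<rho> ^ n)
      \<le> 1 / (1 - \<rho>) + 1 / (1 - \<rho>)"
    using assms by (intro add_mono geom) auto
  finally show ?thesis by simp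
qed

text \<open>The bound has to be uniform in \<open>x\<close>. Completing the square gives
  \<open>- \<beta> * t\<^sup>2 \<le> 1 / (4 * \<beta>) - t\<close>; replacing \<open>x\<close> by
  its floor costs at most 1 in the distance, hence the extra 1 in \<open>L\<close>, and a two-sided
  geometric series remains.\<close>

lemma sum_gaussian_nat_le:
  fixes \<beta> :: real
  assumes \<beta>: "0 < \<beta>"
  obtains M where "0 < M" "\<And>x F. finite F \<Longrightarrow> (\<Sum>m\<in>F. exp (- \<beta> * (x - real m)\<^sup>2)) \<le> M"
proof -
  define L where "L = exp (1 / (4 * \<beta>) + 1)"
  have "(\<Sum>m\<in>F. exp (- \<beta> * (x - real m)\<^sup>2)) \<le> L * (2 / (1 - exp (- 1)))" if F: "finite F" for x F
  proof -
    define d where "d m = \<lfloor>x\<rfloor> - int m" for m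
    have term_le: "exp (- \<beta> * (x - real m)\<^sup>2) \<le> L * exp (- 1) ^ nat \<bar>d m\<bar>" for m
    proof -
      define t where "t = \<bar>x - real m\<bar>"
      have "0 \<le> \<beta> * (t - 1 / (2 * \<beta>))\<^sup>2" using \<beta> by simp
      also have "\<dots> = \<beta> * t\<^sup>2 - t + 1 / (4 * \<beta>)"
        using \<beta> by (simp add: power2_eq_square field_simps)
      finally have "- \<beta> * t\<^sup>2 \<le> 1 / (4 * \<beta>) - t" by simp
      moreover have "real_of_int \<bar>d m\<bar> \<le> t + 1"
        unfolding d_def t_def by linarith
      ultimately have "- \<beta> * t\<^sup>2 \<le> 1 / (4 * \<beta>) + 1 + real (nat \<bar>d m\<bar>) * (- 1)"
        by simp
      then have "exp (- \<beta> * t\<^sup>2) \<le> L * exp (real (nat \<bar>d m\<bar>) * (- 1))"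
        unfolding L_def by (subst exp_add[symmetric]) simp
      then show ?thesis
        unfolding exp_of_nat_mult by (simp add: t_def)
    qed
    have "(\<Sum>m\<in>F. exp (- \<beta> * (x - real m)\<^sup>2)) \<le> L * (\<Sum>m\<in>F. exp (- 1) ^ nat \<bar>d m\<bar>)"
      unfolding sum_distrib_left by (intro sum_mono term_le)
    also have "(\<Sum>m\<in>F. exp (- 1 :: real) ^ nat \<bar>d m\<bar>) = (\<Sum>k\<in>d ` F. exp (- 1) ^ nat \<bar>k\<bar>)"
      by (subst sum.reindex) (auto simp: d_def inj_on_def)
    also have "\<dots> \<le> 2 / (1 - exp (- 1))"
      using F by (intro sum_power_abs_int_le) auto
    finally show ?thesis by (simp add: L_def)
  qed
  then show ?thesis
    by (intro that[of "L * (2 / (1 - exp (- 1)))"]) (auto simp: L_def)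
qed

definition lattice_point :: "nat \<times> nat \<Rightarrow> complex" where
  "lattice_point i = Complex (real (fst i)) (real (snd i))"

lemma sum_gaussian_lattice_le:
  fixes \<beta> :: real
  assumes \<beta>: "0 < \<beta>"
  obtains M where "0 < M"
    "\<And>z I. finite I \<Longrightarrow> (\<Sum>i\<in>I. exp (- \<beta> * (cmod (z - lattice_point i))\<^sup>2)) \<le> M"
proof (rule sum_gaussian_nat_le[OF \<beta>])
  fix M assume M: "0 < M" and le: "\<And>x F. finite F \<Longrightarrow> (\<Sum>m\<in>F. exp (- \<beta> * (x - real m)\<^sup>2)) \<le> M"
  have "(\<Sum>i\<in>I. exp (- \<beta> * (cmod (z - lattice_point i))\<^sup>2)) \<le> M * M" if I: "finite I" for z I
  proof -
    have "(\<Sum>i\<in>I. exp (- \<beta> * (cmod (z - lattice_point i))\<^sup>2))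
        \<le> (\<Sum>i\<in>fst ` I \<times> snd ` I. exp (- \<beta> * (cmod (z - lattice_point i))\<^sup>2))"
      using I by (intro sum_mono2) (auto simp: rev_image_eqI)
    also have "\<dots> = (\<Sum>m\<in>fst ` I. \<Sum>n\<in>snd ` I. exp (- \<beta> * (cmod (z - lattice_point (m, n)))\<^sup>2))"
      by (simp add: sum.cartesian_product)
    also have "\<dots> = (\<Sum>m\<in>fst ` I. exp (- \<beta> * (Re z - real m)\<^sup>2)) * (\<Sum>n\<in>snd ` I. exp (- \<beta> * (Im z - real n)\<^sup>2))"
      unfolding sum_product
      by (intro sum.cong refl) (simp add: cmod_power2 lattice_point_def exp_add[symmetric] algebra_simps)
    also have "\<dots> \<le> M * M"
      using I M by (intro mult_mono le sum_nonneg) auto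
    finally show ?thesis .
  qed
  then show ?thesis using M by (intro that[of "M * M"]) auto
qed

lemma lborel_shift:
  fixes H :: "complex \<Rightarrow> real"
  assumes H: "integrable lborel H"
  shows "integrable lborel (\<lambda>z. H (z - w))" "(LINT z|lborel. H (z - w)) = (LINT z|lborel. H z)"
proof -
  have [measurable]: "H \<in> borel_measurable borel"
    using borel_measurable_integrable[OF H] by simp
  have "integrable (distr lborel borel ((+) (- w))) H"
    using H by (simp add: lborel_distr_plus)
  then show "integrable lborel (\<lambda>z. H (z - w))"
    by (subst (asm) integrable_distr_eq) auto
  have "(LINT z|lborel. H z) = (LINT z|distr lborel borel ((+) (- w)). H z)"
    by (simp add: lborel_distr_plus)
  also have "\<dots> = (LINT z|lborel. H (z - w))"
    by (subst integral_distr) auto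
  finally show "(LINT z|lborel. H (z - w)) = (LINT z|lborel. H z)" ..
qed

section \<open>Normalised kernels and their weak summability\<close>

definition fock_kernel :: "real \<Rightarrow> complex \<Rightarrow> complex \<Rightarrow> complex" where
  "fock_kernel \<alpha> w z = exp (of_real \<alpha> * z * cnj w - of_real (\<alpha> / 2 * (cmod w)\<^sup>2))"

lemma fock_kernel_holomorphic: "fock_kernel \<alpha> w holomorphic_on A"
  unfolding fock_kernel_def[abs_def] by (intro holomorphic_intros)

lemma fock_density_kernel: "fock_density \<alpha> (fock_kernel \<alpha> w) z = exp (- (\<alpha> / 2) * (cmod (z - w))\<^sup>2)"
proof -
  have "Re (of_real \<alpha> * z * cnj w - of_real (\<alpha> / 2 * (cmod w)\<^sup>2)) = \<alpha> * Re (z * cnj w) - \<alpha> / 2 * (cmod w)\<^sup>2"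
    by (simp add: algebra_simps)
  then show ?thesis
    unfolding fock_density_def fock_kernel_def norm_exp_eq_Re
    by (simp add: exp_add[symmetric] cmod_diff_power2 field_simps)
qed

lemma fock_kernel_in_fock_space:
  assumes "0 < \<alpha>" "0 < p"
  shows "fock_kernel \<alpha> w \<in> fock_space \<alpha> p"
  unfolding fock_space_iff
proof
  have "fock_density \<alpha> (fock_kernel \<alpha> w) z powr p = exp (- (p * \<alpha> / 2) * (cmod (z - w))\<^sup>2)" for z
    by (simp add: fock_density_kernel exp_powr_real mult_ac)
  then show "integrable lborel (\<lambda>z. fock_density \<alpha> (fock_kernel \<alpha> w) z powr p)"
    using lborel_shift(1)[OF integrable_gaussian_complex[of "p * \<alpha> / 2"]] assms by simp
qed (rule fock_kernel_holomorphic)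

lemma fock_norm_kernel:
  assumes "0 < \<alpha>" "0 < p"
  shows "fock_norm \<alpha> p (fock_kernel \<alpha> w) = fock_norm \<alpha> p (fock_kernel \<alpha> 0)"
proof -
  have "fock_density \<alpha> (fock_kernel \<alpha> w) z powr p = exp (- (p * \<alpha> / 2) * (cmod (z - w))\<^sup>2)" for w z
    by (simp add: fock_density_kernel exp_powr_real mult_ac)
  then show ?thesis
    using lborel_shift(2)[OF integrable_gaussian_complex[of "p * \<alpha> / 2"]] assms
    by (simp add: fock_norm_def fock_weighted_eq)
qed

text \<open>At each \<open>z\<close> the Gaussians of the kernels have total at most
  \<open>M\<close>, so \<open>powr_sum_le\<close> with these as weights moves the power
  \<open>p\<close> onto the coefficients; integration in \<open>z\<close> turns every Gaussian into
  the same constant \<open>G\<close>.\<close>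

lemma fock_norm_kernel_sum_le:
  fixes \<alpha> p :: real
  assumes \<alpha>: "0 < \<alpha>" and p: "1 \<le> p"
  obtains K where "0 \<le> K" "\<And>I c. finite I \<Longrightarrow>
    fock_norm \<alpha> p (\<lambda>z. \<Sum>i\<in>I. c i * fock_kernel \<alpha> (lattice_point i) z) powr p \<le> K * (\<Sum>i\<in>I. cmod (c i) powr p)"
proof (rule sum_gaussian_lattice_le[of "\<alpha> / 2"])
  fix M assume M: "0 < M" and le: "\<And>z I. finite I \<Longrightarrow>
    (\<Sum>i\<in>I. exp (- (\<alpha> / 2) * (cmod (z - lattice_point i))\<^sup>2)) \<le> M"
  define G where "G = (LINT z|lborel. exp (- (\<alpha> / 2) * (cmod z)\<^sup>2))"
  have gauss: "integrable lborel (\<lambda>z::complex. exp (- (\<alpha> / 2) * (cmod z)\<^sup>2))"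
    using \<alpha> by (intro integrable_gaussian_complex) auto
  note shift = lborel_shift[OF gauss]
  have "fock_norm \<alpha> p (\<lambda>z. \<Sum>i\<in>I. c i * fock_kernel \<alpha> (lattice_point i) z) powr p
      \<le> ((M + 1) powr p * G) * (\<Sum>i\<in>I. cmod (c i) powr p)" if I: "finite I" for I c
  proof -
    let ?E = "\<lambda>i z. exp (- (\<alpha> / 2) * (cmod (z - lattice_point i))\<^sup>2)"
    have "fock_norm \<alpha> p (\<lambda>z. \<Sum>i\<in>I. c i * fock_kernel \<alpha> (lattice_point i) z) powr p
        \<le> (LINT z|lborel. (M + 1) powr p * (\<Sum>i\<in>I. cmod (c i) powr p * ?E i z))"
    proof (rule fock_norm_powr_le)
      show "integrable lborel (\<lambda>z. (M + 1) powr p * (\<Sum>i\<in>I. cmod (c i) powr p * ?E i z))"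
        by (intro integrable_mult_right Bochner_Integration.integrable_sum shift)
      fix z
      have "fock_density \<alpha> (\<lambda>z. \<Sum>i\<in>I. c i * fock_kernel \<alpha> (lattice_point i) z) z
          \<le> (\<Sum>i\<in>I. ?E i z * cmod (c i))"
        using fock_density_sum[of \<alpha> c "\<lambda>i. fock_kernel \<alpha> (lattice_point i)" I z]
        by (simp add: fock_density_kernel mult.commute)
      then have "fock_density \<alpha> (\<lambda>z. \<Sum>i\<in>I. c i * fock_kernel \<alpha> (lattice_point i) z) z powr p
          \<le> (\<Sum>i\<in>I. ?E i z * cmod (c i)) powr p"
        using p by (intro powr_mono2) auto
      also have "\<dots> \<le> (M + 1) powr p * (\<Sum>i\<in>I. ?E i z * cmod (c i) powr p)"
        using I p by (intro powr_sum_le le) auto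
      finally show "fock_density \<alpha> (\<lambda>z. \<Sum>i\<in>I. c i * fock_kernel \<alpha> (lattice_point i) z) z powr p
          \<le> (M + 1) powr p * (\<Sum>i\<in>I. cmod (c i) powr p * ?E i z)"
        by (simp only: mult.commute[of "?E _ z"])
    qed (use p in auto)
    also have "\<dots> = (M + 1) powr p * (\<Sum>i\<in>I. cmod (c i) powr p * (LINT z|lborel. ?E i z))"
      by (subst integral_mult_right_zero, subst Bochner_Integration.integral_sum)
        (intro integrable_mult_right shift, subst integral_mult_right_zero, rule refl)
    also have "\<dots> = ((M + 1) powr p * G) * (\<Sum>i\<in>I. cmod (c i) powr p)"
      unfolding shift(2) G_def by (simp add: sum_distrib_right[symmetric] mult_ac)
    finally show ?thesis .
  qed
  then show ?thesis
    by (rule that[rotated]) (auto simp: G_def intro!: mult_nonneg_nonneg integral_nonneg_AE)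
qed (use \<alpha> in auto)

text \<open>Duality with the conjugate exponent \<open>s = p / (p - 1)\<close>: testing
  \<open>\<phi>\<close> on an extremal combination of kernels gives
  \<open>S powr p \<le> K * S\<close> for the sum \<open>S\<close> of \<open>s\<close>-th powers, so
  \<open>S\<close> is bounded. Larger exponents follow because single terms are then bounded
  too.\<close>

lemma fock_kernel_weakly_summable:
  fixes \<alpha> p q :: real
  assumes \<alpha>: "0 < \<alpha>" and p: "1 < p" and q: "p / (p - 1) \<le> q"
  obtains K where "0 < K" "\<And>I \<phi>. finite I \<Longrightarrow> \<phi> \<in> dual_ball (fock_space \<alpha> p) (fock_norm \<alpha> p) \<Longrightarrow>
    (\<Sum>i\<in>I. cmod (\<phi> (fock_kernel \<alpha> (lattice_point i))) powr q) \<le> K"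
proof (rule fock_norm_kernel_sum_le[of \<alpha> p])
  fix K assume K: "0 \<le> K" and le: "\<And>I c. finite I \<Longrightarrow>
    fock_norm \<alpha> p (\<lambda>z. \<Sum>i\<in>I. c i * fock_kernel \<alpha> (lattice_point i) z) powr p \<le> K * (\<Sum>i\<in>I. cmod (c i) powr p)"
  define s where "s = p / (p - 1)"
  have s: "1 < s" "p * (s - 1) = s" "s \<le> q"
    using p q by (auto simp: s_def field_simps)
  define L where "L = K powr (1 / (p - 1))"
  have dual: "(\<Sum>i\<in>I. cmod (\<phi> (fock_kernel \<alpha> (lattice_point i))) powr s) \<le> L"
    if I: "finite I" and \<phi>: "\<phi> \<in> dual_ball (fock_space \<alpha> p) (fock_norm \<alpha> p)" for I \<phi>
  proof -
    define y where "y i = \<phi> (fock_kernel \<alpha> (lattice_point i))" for i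
    define S where "S = (\<Sum>i\<in>I. cmod (y i) powr s)"
    \<comment> \<open>The equality case of Hoelder: \<open>c i * y i\<close> is
      \<open>cmod (y i) powr s\<close>, and so is \<open>cmod (c i) powr p\<close>, because
      \<open>p * (s - 1) = s\<close>.\<close>
    define c where "c i = cnj (y i) * of_real (cmod (y i) powr (s - 2))" for i
    have S: "0 \<le> S" unfolding S_def by (intro sum_nonneg) auto
    have cy: "c i * y i = of_real (cmod (y i) powr s)" for i
    proof (cases "y i = 0")
      case False
      have "c i * y i = of_real ((cmod (y i))\<^sup>2 * cmod (y i) powr (s - 2))"
        unfolding c_def of_real_mult complex_norm_square by simp
      also have "(cmod (y i))\<^sup>2 * cmod (y i) powr (s - 2) = cmod (y i) powr s"
        using False by (simp add: powr_numeral[symmetric] powr_add[symmetric] del: powr_numeral)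
      finally show ?thesis .
    qed (simp add: c_def)
    have c_powr: "cmod (c i) powr p = cmod (y i) powr s" for i
    proof (cases "y i = 0")
      case False
      have "cmod (c i) = cmod (y i) powr (s - 1)"
        using False powr_mult_base[of "cmod (y i)" "s - 2"] by (simp add: c_def norm_mult)
      then show ?thesis using s by (simp add: powr_powr mult.commute)
    qed (simp add: c_def)
    let ?h = "\<lambda>z. \<Sum>i\<in>I. c i * fock_kernel \<alpha> (lattice_point i) z"
    have ker: "fock_kernel \<alpha> w \<in> fock_space \<alpha> p" for w
      using \<alpha> p by (intro fock_kernel_in_fock_space) auto
    have h: "?h \<in> fock_space \<alpha> p"
      using p by (intro fock_space_sum I ker) auto
    have "\<phi> ?h = (\<Sum>i\<in>I. c i * y i)"
      unfolding y_def using p by (intro dual_ball_sum[OF \<phi>] I ker) auto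
    also have "\<dots> = of_real S"
      by (simp add: cy S_def)
    finally have "S = cmod (\<phi> ?h)" using S by simp
    also have "\<dots> \<le> fock_norm \<alpha> p ?h"
      using \<phi> h by (simp add: dual_ball_def)
    finally have "S powr p \<le> fock_norm \<alpha> p ?h powr p"
      using S p by (intro powr_mono2) auto
    also have "\<dots> \<le> K * S"
      using le[OF I, of c] by (simp add: S_def c_powr)
    finally have Sp: "S powr p \<le> K * S" .
    have "S \<le> L"
    proof (cases "S = 0")
      case False
      then have S0: "0 < S" using S by simp
      then have "S * S powr (p - 1) \<le> S * K"
        using Sp powr_mult_base[of S "p - 1"] by (simp add: mult.commute)
      then have "S powr (p - 1) \<le> K" using S0 by simp
      then have "(S powr (p - 1)) powr (1 / (p - 1)) \<le> L"
        unfolding L_def using p by (intro powr_mono2) auto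
      then show ?thesis using p S0 by (simp add: powr_powr)
    qed (simp add: L_def)
    then show ?thesis by (simp add: S_def y_def)
  qed
  \<comment> \<open>The surplus \<open>q - s\<close> powers are bounded termwise, by
    \<open>dual\<close> for singletons; the 1 makes the constant positive.\<close>
  have "(\<Sum>i\<in>I. cmod (\<phi> (fock_kernel \<alpha> (lattice_point i))) powr q) \<le> (L powr (1 / s)) powr (q - s) * L + 1"
    if I: "finite I" and \<phi>: "\<phi> \<in> dual_ball (fock_space \<alpha> p) (fock_norm \<alpha> p)" for I \<phi>
  proof -
    let ?y = "\<lambda>i. cmod (\<phi> (fock_kernel \<alpha> (lattice_point i)))"
    have "?y i \<le> L powr (1 / s)" for i
    proof -
      have "(?y i powr s) powr (1 / s) \<le> L powr (1 / s)"
        using dual[of "{i}", OF _ \<phi>] s by (intro powr_mono2) auto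
      then show ?thesis using s by (simp add: powr_powr)
    qed
    then have "?y i powr q \<le> (L powr (1 / s)) powr (q - s) * ?y i powr s" for i
    proof -
      assume *: "\<And>i. ?y i \<le> L powr (1 / s)"
      have "?y i powr q = ?y i powr (q - s) * ?y i powr s"
        by (simp add: powr_add[symmetric])
      also have "\<dots> \<le> (L powr (1 / s)) powr (q - s) * ?y i powr s"
        using * s by (intro mult_right_mono powr_mono2) auto
      finally show ?thesis .
    qed
    then have "(\<Sum>i\<in>I. ?y i powr q) \<le> (L powr (1 / s)) powr (q - s) * (\<Sum>i\<in>I. ?y i powr s)"
      unfolding sum_distrib_left by (intro sum_mono)
    also have "\<dots> \<le> (L powr (1 / s)) powr (q - s) * L"
      by (intro mult_left_mono dual I \<phi>) auto
    finally show ?thesis by simp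
  qed
  then show ?thesis
    by (rule that[rotated]) (auto simp: L_def intro!: add_nonneg_pos mult_nonneg_nonneg)
qed (use \<alpha> p in auto)

section \<open>Summability forces a constant derivative\<close>

text \<open>Cauchy's estimate on the circle of radius \<open>1 / (1 + cmod w)\<close>. There
  \<open>(cmod x)\<^sup>2\<close> exceeds \<open>(cmod w)\<^sup>2\<close> by at most 3, so the
  weight changes by a bounded factor only, and the short radius costs the factor
  \<open>1 + cmod w\<close>.\<close>

lemma fock_deriv_bound:
  fixes \<alpha> A :: real
  assumes \<alpha>: "0 < \<alpha>" and h: "h holomorphic_on UNIV" and A: "\<And>z. fock_density \<alpha> h z \<le> A"
  shows "cmod (deriv h w) * exp (- (\<alpha> / 2) * (cmod w)\<^sup>2) \<le> exp (3 * \<alpha> / 2) * (1 + cmod w) * A"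
proof -
  define R where "R = cmod w"
  define \<rho> where "\<rho> = 1 / (1 + R)"
  have R: "0 \<le> R" by (simp add: R_def)
  then have \<rho>: "0 < \<rho>" "\<rho> \<le> 1" "R * \<rho> \<le> 1" by (auto simp: \<rho>_def)
  have A0: "0 \<le> A" by (rule order_trans[OF fock_density_nonneg A])
  define B where "B = A * exp (\<alpha> / 2 * (R\<^sup>2 + 3))"
  have "cmod ((deriv ^^ 1) h w) \<le> fact 1 * B / \<rho> ^ 1"
  proof (rule Cauchy_inequality)
    show "h holomorphic_on ball w \<rho>" "continuous_on (cball w \<rho>) h"
      using h by (auto intro: holomorphic_on_subset holomorphic_on_imp_continuous_on)
    fix x assume x: "cmod (w - x) = \<rho>"
    have "cmod x \<le> R + \<rho>"
      using norm_triangle_ineq4[of w "w - x"] x by (simp add: R_def)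
    then have "(cmod x)\<^sup>2 \<le> (R + \<rho>)\<^sup>2" by (intro power_mono) auto
    also have "\<dots> = R\<^sup>2 + 2 * (R * \<rho>) + \<rho> * \<rho>"
      by (simp add: power2_eq_square algebra_simps)
    also have "\<dots> \<le> R\<^sup>2 + 2 * 1 + 1 * 1"
      using \<rho> by (intro add_mono mult_mono mult_left_mono) auto
    finally have "\<alpha> / 2 * (cmod x)\<^sup>2 \<le> \<alpha> / 2 * (R\<^sup>2 + 3)"
      using \<alpha> by (intro mult_left_mono) auto
    then have "A * exp (\<alpha> / 2 * (cmod x)\<^sup>2) \<le> B"
      unfolding B_def using A0 by (intro mult_left_mono) auto
    moreover have "cmod (h x) \<le> A * exp (\<alpha> / 2 * (cmod x)\<^sup>2)"
      using A[of x] by (simp add: fock_density_def exp_minus field_simps)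
    ultimately show "cmod (h x) \<le> B" by simp
  qed (rule \<rho>)
  then have "cmod (deriv h w) * exp (- (\<alpha> / 2) * R\<^sup>2) \<le> (B * (1 + R)) * exp (- (\<alpha> / 2) * R\<^sup>2)"
    by (intro mult_right_mono) (auto simp: \<rho>_def)
  also have "\<dots> = exp (3 * \<alpha> / 2) * (1 + R) * A"
  proof -
    have "exp (\<alpha> / 2 * (R\<^sup>2 + 3)) * exp (- (\<alpha> / 2) * R\<^sup>2) = exp (3 * \<alpha> / 2)"
      by (simp add: exp_add[symmetric] algebra_simps)
    then show ?thesis by (simp add: B_def mult_ac)
  qed
  finally show ?thesis by (simp add: R_def)
qed

text \<open>The kernel has density 1 at its own centre, so the weighted derivative of its image at
  \<open>w\<close> has modulus \<open>cmod (deriv g w)\<close>; \<open>fock_deriv_bound\<close> and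
  bounded point evaluation estimate it by the norm.\<close>

lemma deriv_le_fock_norm_volterra_kernel:
  fixes \<alpha> p :: real
  assumes \<alpha>: "0 < \<alpha>" and p: "1 \<le> p" and g: "g holomorphic_on UNIV"
    and mem: "\<And>f. f \<in> fock_space \<alpha> p \<Longrightarrow> volterra g f \<in> fock_space \<alpha> p"
  obtains C where "0 < C"
    "\<And>w. cmod (deriv g w) \<le> C * (1 + cmod w) * fock_norm \<alpha> p (volterra g (fock_kernel \<alpha> w))"
proof (rule fock_eval[OF \<alpha> p])
  fix C assume C: "0 < C"
    and eval: "\<And>f w. f \<in> fock_space \<alpha> p \<Longrightarrow> fock_density \<alpha> f w \<le> C * fock_norm \<alpha> p f"
  have "cmod (deriv g w) \<le> exp (3 * \<alpha> / 2) * C * (1 + cmod w) * fock_norm \<alpha> p (volterra g (fock_kernel \<alpha> w))" for w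
  proof -
    have k: "fock_kernel \<alpha> w \<in> fock_space \<alpha> p"
      using \<alpha> p by (intro fock_kernel_in_fock_space) auto
    have "deriv (volterra g (fock_kernel \<alpha> w)) w = fock_kernel \<alpha> w w * deriv g w"
      by (intro DERIV_imp_deriv volterra_has_field_derivative g fock_kernel_holomorphic)
    moreover have "cmod (deriv (volterra g (fock_kernel \<alpha> w)) w) * exp (- (\<alpha> / 2) * (cmod w)\<^sup>2)
        \<le> exp (3 * \<alpha> / 2) * (1 + cmod w) * (C * fock_norm \<alpha> p (volterra g (fock_kernel \<alpha> w)))"
      by (intro fock_deriv_bound \<alpha> eval mem k volterra_holomorphic g fock_kernel_holomorphic)
    moreover have "cmod (fock_kernel \<alpha> w w) * exp (- (\<alpha> / 2) * (cmod w)\<^sup>2) = 1"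
      using fock_density_kernel[of \<alpha> w w] by (simp add: fock_density_def)
    ultimately show ?thesis
      by (simp add: norm_mult mult_ac)
  qed
  then show ?thesis
    using C by (intro that[of "exp (3 * \<alpha> / 2) * C"]) auto
qed


lemma volterra_r_summing_imp_deriv_const:
  fixes \<alpha> p r :: real
  assumes \<alpha>: "0 < \<alpha>" and p: "1 < p" and r: "1 \<le> r" and g: "g holomorphic_on UNIV"
    and summing: "volterra_r_summing r \<alpha> p g"
  obtains b where "\<And>z. deriv g z = b"
proof -
  \<comment> \<open>At the larger exponent the operator is still summing and the kernels are weakly
    summable.\<close>
  define q where "q = max r (p / (p - 1))"
  have q: "1 \<le> q" "r \<le> q" "p / (p - 1) \<le> q"
    using r by (auto simp: q_def)
  have "volterra_r_summing q \<alpha> p g"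
    by (rule volterra_r_summing_mono[OF summing]) (use r q p in auto)
  then have summing_q: "r_summing q (fock_space \<alpha> p) (fock_norm \<alpha> p) (fock_space \<alpha> p) (fock_norm \<alpha> p) (volterra g)"
    by (simp add: volterra_r_summing_def)
  then have mem: "volterra g f \<in> fock_space \<alpha> p" if "f \<in> fock_space \<alpha> p" for f
    using that unfolding r_summing_def linear_operator_def by blast
  have ker: "fock_kernel \<alpha> w \<in> fock_space \<alpha> p" for w
    using \<alpha> p by (intro fock_kernel_in_fock_space) auto
  let ?N = "\<lambda>w. fock_norm \<alpha> p (volterra g (fock_kernel \<alpha> w))"
  obtain C where C: "0 < C" and deriv_le: "\<And>w. cmod (deriv g w) \<le> C * (1 + cmod w) * ?N w"
    by (rule deriv_le_fock_norm_volterra_kernel[OF \<alpha> less_imp_le[OF p] g mem]) blast+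
  define \<nu> where "\<nu> = fock_norm \<alpha> p (fock_kernel \<alpha> 0)"
  \<comment> \<open>Families of one vector, indexed by \<open>unit\<close>: summability contains
    boundedness, hence a uniform bound for the images of all kernels.\<close>
  obtain C1 where C1: "0 < C1" and le1: "\<And>(I :: unit set) x B. finite I \<Longrightarrow> (\<And>i. i \<in> I \<Longrightarrow> x i \<in> fock_space \<alpha> p) \<Longrightarrow>
      (\<And>\<phi>. \<phi> \<in> dual_ball (fock_space \<alpha> p) (fock_norm \<alpha> p) \<Longrightarrow> (\<Sum>i\<in>I. cmod (\<phi> (x i)) powr q) \<le> B) \<Longrightarrow>
      (\<Sum>i\<in>I. fock_norm \<alpha> p (volterra g (x i)) powr q) \<le> C1 * B"
    by (rule r_summingD[OF summing_q q(1) fock_norm_nonneg, where 'i = unit]) blast+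
  have "?N w powr q \<le> C1 * \<nu> powr q" for w
  proof -
    have "cmod (\<phi> (fock_kernel \<alpha> w)) powr q \<le> \<nu> powr q"
      if "\<phi> \<in> dual_ball (fock_space \<alpha> p) (fock_norm \<alpha> p)" for \<phi>
      using that ker[of w] fock_norm_kernel[of \<alpha> p w] \<alpha> p q
      by (intro powr_mono2) (auto simp: dual_ball_def \<nu>_def)
    then show ?thesis
      using le1[of UNIV "\<lambda>_. fock_kernel \<alpha> w" "\<nu> powr q"] ker by (simp add: UNIV_unit)
  qed
  then have N_le: "?N w \<le> (C1 * \<nu> powr q) powr (1 / q)" for w
  proof -
    assume "\<And>w. ?N w powr q \<le> C1 * \<nu> powr q"
    then have "(?N w powr q) powr (1 / q) \<le> (C1 * \<nu> powr q) powr (1 / q)"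
      using q by (intro powr_mono2) auto
    then show ?thesis using q by (simp add: powr_powr)
  qed
  define D where "D = C * (C1 * \<nu> powr q) powr (1 / q)"
  have D: "0 \<le> D" using C by (simp add: D_def)
  have deriv_le': "cmod (deriv g w) \<le> D * (1 + cmod w)" for w
  proof -
    have "cmod (deriv g w) \<le> C * (1 + cmod w) * (C1 * \<nu> powr q) powr (1 / q)"
      using C by (intro order_trans[OF deriv_le] mult_left_mono N_le) auto
    then show ?thesis by (simp add: D_def mult_ac)
  qed
  have hol': "deriv g holomorphic_on UNIV"
    using g by (intro holomorphic_intros) auto
  define a where "a = (deriv ^^ 1) (deriv g) 0"
  define b where "b = deriv g 0"
  have affine: "deriv g z = a * z + b" for z
  proof -
    \<comment> \<open>Linear growth outside the unit disc leaves only a polynomial of degree at most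
      1.\<close>
    have "deriv g z = (\<Sum>k\<le>1. (deriv ^^ k) (deriv g) 0 / fact k * z ^ k)"
    proof (rule Liouville_polynomial[OF hol'])
      fix w :: complex assume "1 \<le> cmod w"
      then have "D * (1 + cmod w) \<le> D * (2 * cmod w)"
        using D by (intro mult_left_mono) auto
      with deriv_le'[of w] show "cmod (deriv g w) \<le> (2 * D) * cmod w ^ 1" by simp
    qed
    then show ?thesis by (simp add: a_def b_def)
  qed
  obtain K where K: "0 < K" and weak: "\<And>I \<phi>. finite I \<Longrightarrow> \<phi> \<in> dual_ball (fock_space \<alpha> p) (fock_norm \<alpha> p) \<Longrightarrow>
    (\<Sum>i\<in>I. cmod (\<phi> (fock_kernel \<alpha> (lattice_point i))) powr q) \<le> K"
    by (rule fock_kernel_weakly_summable[OF \<alpha> p q(3)]) blast+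
  obtain C2 where C2: "0 < C2" and le2: "\<And>(I :: (nat \<times> nat) set) x B. finite I \<Longrightarrow> (\<And>i. i \<in> I \<Longrightarrow> x i \<in> fock_space \<alpha> p) \<Longrightarrow>
      (\<And>\<phi>. \<phi> \<in> dual_ball (fock_space \<alpha> p) (fock_norm \<alpha> p) \<Longrightarrow> (\<Sum>i\<in>I. cmod (\<phi> (x i)) powr q) \<le> B) \<Longrightarrow>
      (\<Sum>i\<in>I. fock_norm \<alpha> p (volterra g (x i)) powr q) \<le> C2 * B"
    by (rule r_summingD[OF summing_q q(1) fock_norm_nonneg, where 'i = "nat \<times> nat"]) blast+
  \<comment> \<open>Dividing by \<open>Suc j\<close> removes the factor \<open>1 + cmod w\<close> of
    \<open>deriv_le\<close>. The terms are dominated by the summable powers of the norms at the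
    integers, yet converge to \<open>cmod a powr q\<close>, so \<open>a = 0\<close>.\<close>
  define \<tau> where "\<tau> j = cmod ((a * of_nat j + b) / of_nat (Suc j)) powr q" for j
  have \<tau>_le: "\<tau> j \<le> C powr q * ?N (of_nat j) powr q" for j
  proof -
    have "cmod (a * of_nat j + b) \<le> C * (1 + real j) * ?N (of_nat j)"
      using deriv_le[of "of_nat j"] by (simp add: affine)
    then have "cmod ((a * of_nat j + b) / of_nat (Suc j)) \<le> C * ?N (of_nat j)"
      unfolding norm_divide norm_of_nat by (simp add: field_simps)
    then have "\<tau> j \<le> (C * ?N (of_nat j)) powr q"
      unfolding \<tau>_def using q by (intro powr_mono2) auto
    then show ?thesis using C by (simp add: powr_mult)
  qed
  have "(\<Sum>j<n. \<tau> j) \<le> C powr q * (C2 * K)" for n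
  proof -
    have "(\<Sum>i\<in>(\<lambda>j. (j, 0)) ` {..<n}. ?N (lattice_point i) powr q) \<le> C2 * K"
      by (intro le2 weak ker) auto
    also have "(\<Sum>i\<in>(\<lambda>j. (j, 0)) ` {..<n}. ?N (lattice_point i) powr q) = (\<Sum>j<n. ?N (of_nat j) powr q)"
      by (subst sum.reindex) (auto simp: inj_on_def lattice_point_def complex_eq_iff intro!: sum.cong arg_cong[where f = "\<lambda>w. ?N w powr q"])
    finally have "C powr q * (\<Sum>j<n. ?N (of_nat j) powr q) \<le> C powr q * (C2 * K)"
      by (intro mult_left_mono) auto
    moreover have "(\<Sum>j<n. \<tau> j) \<le> C powr q * (\<Sum>j<n. ?N (of_nat j) powr q)"
      unfolding sum_distrib_left by (intro sum_mono \<tau>_le)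
    ultimately show ?thesis by linarith
  qed
  then have "summable \<tau>"
    by (intro summableI_nonneg_bounded) (auto simp: \<tau>_def)
  then have "\<tau> \<longlonglongrightarrow> 0" by (rule summable_LIMSEQ_zero)
  moreover have "\<tau> \<longlonglongrightarrow> cmod a powr q"
  proof -
    have "(\<lambda>j. a + (b - a) * inverse (of_nat (Suc j))) \<longlonglongrightarrow> a + (b - a) * 0"
      by (intro tendsto_add tendsto_mult tendsto_const LIMSEQ_Suc[OF lim_inverse_n])
    moreover have "a + (b - a) * inverse (of_nat (Suc j)) = (a * of_nat j + b) / of_nat (Suc j)" for j
    proof -
      have "a + (b - a) * inverse (of_nat (Suc j)) = (a * of_nat (Suc j) + (b - a)) / of_nat (Suc j)"
        by (simp add: field_simps del: of_nat_Suc)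
      then show ?thesis by (simp add: algebra_simps)
    qed
    ultimately have "(\<lambda>j. (a * of_nat j + b) / of_nat (Suc j)) \<longlonglongrightarrow> a"
      by simp
    then show ?thesis
      unfolding \<tau>_def using q by (intro tendsto_powr' tendsto_norm tendsto_const) auto
  qed
  ultimately have "cmod a powr q = 0"
    using LIMSEQ_unique by blast
  then have "a = 0" by simp
  then show ?thesis using affine that by simp
qed

subsection \<open>Random signs\<close>

text \<open>A sign pattern is encoded by the set \<open>A\<close> of indices carrying a plus, so the
  average over all signs is a sum over \<open>Pow I\<close> divided by
  \<open>2 ^ card I\<close>.\<close>

definition rademacher :: "'i set \<Rightarrow> 'i \<Rightarrow> real" where
  "rademacher A i = (if i \<in> A then 1 else - 1)"

text \<open>Independence of the signs: expanding the product chooses one summand per index, that is,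
  one subset of \<open>I\<close>.\<close>

lemma sum_exp_rademacher:
  assumes "finite I"
  shows "(\<Sum>A\<in>Pow I. exp (\<Sum>i\<in>I. rademacher A i * b i)) = (\<Prod>i\<in>I. exp (b i) + exp (- b i))"
proof -
  have "exp (\<Sum>i\<in>I. rademacher A i * b i) = (\<Prod>i\<in>A. exp (b i)) * (\<Prod>i\<in>I - A. exp (- b i))"
    if "A \<in> Pow I" for A
  proof -
    have "exp (\<Sum>i\<in>I. rademacher A i * b i) = (\<Prod>i\<in>I. exp (rademacher A i * b i))"
      using assms by (rule exp_sum)
    also have "\<dots> = (\<Prod>i\<in>I - A. exp (rademacher A i * b i)) * (\<Prod>i\<in>A. exp (rademacher A i * b i))"
      using that assms by (intro prod.subset_diff) auto
    finally show ?thesis by (simp add: rademacher_def mult.commute)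
  qed
  then show ?thesis
    unfolding prod_add[OF assms] by (rule sum.cong[OF refl])
qed

lemma exp_add_exp_minus_le:
  fixes b :: real
  assumes "\<bar>b\<bar> \<le> 1"
  shows "exp b + exp (- b) \<le> 2 * exp (b\<^sup>2)"
proof -
  define c where "c = \<bar>b\<bar>"
  have c: "0 \<le> c" "c \<le> 1" using assms by (auto simp: c_def)
  have 1: "exp c \<le> 1 + c + c\<^sup>2" using c by (intro exp_bound) auto
  have 2: "exp (- c) \<le> 1 - c + c\<^sup>2"
  proof -
    have "exp (- c) * (1 + c) \<le> exp (- c) * exp c"
      by (intro mult_left_mono exp_ge_add_one_self) auto
    also have "\<dots> = 1" by (simp add: exp_add[symmetric])
    \<comment> \<open>The right side is \<open>1 + c ^ 3\<close>.\<close>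
    also have "1 \<le> (1 - c + c\<^sup>2) * (1 + c)"
      using c by (simp add: power2_eq_square algebra_simps)
    finally show ?thesis using c by (simp add: mult_le_cancel_right)
  qed
  have "exp b + exp (- b) = exp c + exp (- c)"
    by (auto simp: c_def abs_if)
  also have "\<dots> \<le> 2 * (1 + c\<^sup>2)" using 1 2 by simp
  also have "\<dots> \<le> 2 * exp (b\<^sup>2)"
    unfolding c_def power2_abs by (intro mult_left_mono exp_ge_add_one_self) auto
  finally show ?thesis .
qed

text \<open>Apply \<open>t \<le> exp t\<close> to \<open>t = \<bar>x\<bar> / q\<close>. This trades
  \<open>q\<close>-th powers for exponential moments, which factorise over independent
  signs.\<close>

lemma abs_powr_le_exp:
  fixes x q :: real
  assumes q: "0 < q"
  shows "\<bar>x\<bar> powr q \<le> q powr q * (exp x + exp (- x))"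
proof -
  have "\<bar>x\<bar> / q \<le> exp (\<bar>x\<bar> / q)"
    using exp_ge_add_one_self[of "\<bar>x\<bar> / q"] by linarith
  then have "(\<bar>x\<bar> / q) powr q \<le> exp (\<bar>x\<bar> / q) powr q"
    using q by (intro powr_mono2) auto
  then have "\<bar>x\<bar> powr q \<le> q powr q * exp \<bar>x\<bar>"
    using q by (simp add: powr_divide exp_powr_real divide_le_eq mult.commute)
  also have "\<dots> \<le> q powr q * (exp x + exp (- x))"
    by (intro mult_left_mono) (auto simp: abs_if)
  finally show ?thesis .
qed

text \<open>Since the squares sum to at most 1, each \<open>\<bar>b i\<bar>\<close> is at most 1, so
  the product formula and the estimate for a single sign bound the average exponential moment by
  \<open>exp 1\<close>.\<close>

lemma khinchine_real:
  fixes b :: "'i \<Rightarrow> real" and q :: real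
  assumes I: "finite I" and q: "0 < q" and b: "(\<Sum>i\<in>I. (b i)\<^sup>2) \<le> 1"
  shows "(\<Sum>A\<in>Pow I. \<bar>\<Sum>i\<in>I. rademacher A i * b i\<bar> powr q) \<le> 2 * q powr q * exp 1 * 2 ^ card I"
proof -
  \<comment> \<open>Stated for every \<open>c\<close> with the same squares, so that it applies to
    \<open>b\<close> and to its negative.\<close>
  have exp_le: "(\<Sum>A\<in>Pow I. exp (\<Sum>i\<in>I. rademacher A i * c i)) \<le> exp 1 * 2 ^ card I"
    if c: "\<And>i. (c i)\<^sup>2 = (b i)\<^sup>2" for c
  proof -
    have "\<bar>c i\<bar> \<le> 1" if "i \<in> I" for i
    proof -
      have "(c i)\<^sup>2 \<le> (\<Sum>i\<in>I. (c i)\<^sup>2)"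
        using I that by (intro member_le_sum) auto
      then have "(c i)\<^sup>2 \<le> 1" using b unfolding c by linarith
      then show ?thesis by (simp add: abs_square_le_1)
    qed
    then have "(\<Prod>i\<in>I. exp (c i) + exp (- c i)) \<le> (\<Prod>i\<in>I. 2 * exp ((c i)\<^sup>2))"
      by (intro prod_mono) (auto intro!: exp_add_exp_minus_le add_nonneg_nonneg)
    also have "\<dots> = 2 ^ card I * exp (\<Sum>i\<in>I. (b i)\<^sup>2)"
      by (simp add: prod.distrib exp_sum[OF I] c)
    also have "\<dots> \<le> 2 ^ card I * exp 1"
      using b by (intro mult_left_mono) auto
    finally show ?thesis
      by (simp only: sum_exp_rademacher[OF I] mult.commute[of "exp 1"])
  qed
  have "(\<Sum>A\<in>Pow I. \<bar>\<Sum>i\<in>I. rademacher A i * b i\<bar> powr q)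
      \<le> (\<Sum>A\<in>Pow I. q powr q * (exp (\<Sum>i\<in>I. rademacher A i * b i) + exp (- (\<Sum>i\<in>I. rademacher A i * b i))))"
    by (intro sum_mono abs_powr_le_exp q)
  also have "\<dots> = q powr q * ((\<Sum>A\<in>Pow I. exp (\<Sum>i\<in>I. rademacher A i * b i)) + (\<Sum>A\<in>Pow I. exp (\<Sum>i\<in>I. rademacher A i * (- b i))))"
    by (simp add: sum_distrib_left[symmetric] sum.distrib sum_negf)
  also have "\<dots> \<le> q powr q * (exp 1 * 2 ^ card I + exp 1 * 2 ^ card I)"
    by (intro mult_left_mono add_mono exp_le) auto
  finally show ?thesis by simp
qed

text \<open>Real and imaginary parts are treated separately after scaling by \<open>sqrt Q\<close>.
  The factor \<open>2 powr q\<close> comes from bounding the sum of the two parts by twice their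
  maximum; adding the two real estimates doubles the constant 2 to 4.\<close>

lemma khinchine:
  fixes b :: "'i \<Rightarrow> complex" and q Q :: real
  assumes I: "finite I" and q: "0 < q" and Q: "0 < Q" "(\<Sum>i\<in>I. (cmod (b i))\<^sup>2) \<le> Q"
  shows "(\<Sum>A\<in>Pow I. cmod (\<Sum>i\<in>I. of_real (rademacher A i) * b i) powr q)
    \<le> 4 * 2 powr q * q powr q * exp 1 * 2 ^ card I * Q powr (q / 2)"
proof -
  define s where "s = sqrt Q"
  have s: "0 < s" "s\<^sup>2 = Q" using Q by (auto simp: s_def)
  have sq: "s powr q = Q powr (q / 2)"
    using Q by (simp add: s_def powr_half_sqrt[symmetric] powr_powr)
  have part: "(\<Sum>A\<in>Pow I. \<bar>\<Sum>i\<in>I. rademacher A i * (c i / s)\<bar> powr q) \<le> 2 * q powr q * exp 1 * 2 ^ card I"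
    if "\<And>i. \<bar>c i\<bar> \<le> cmod (b i)" for c
  proof (rule khinchine_real[OF I q])
    have "(\<Sum>i\<in>I. (c i / s)\<^sup>2) = (\<Sum>i\<in>I. (c i)\<^sup>2) / Q"
      by (simp add: power_divide s sum_divide_distrib)
    also have "(\<Sum>i\<in>I. (c i)\<^sup>2) \<le> (\<Sum>i\<in>I. (cmod (b i))\<^sup>2)"
      using that by (intro sum_mono) (simp add: abs_le_square_iff[symmetric])
    also have "\<dots> \<le> Q" by (rule Q)
    finally show "(\<Sum>i\<in>I. (c i / s)\<^sup>2) \<le> 1"
      using Q by (simp add: divide_right_mono)
  qed
  have "cmod (\<Sum>i\<in>I. of_real (rademacher A i) * b i) powr q
      \<le> 2 powr q * s powr q * (\<bar>\<Sum>i\<in>I. rademacher A i * (Re (b i) / s)\<bar> powr q + \<bar>\<Sum>i\<in>I. rademacher A i * (Im (b i) / s)\<bar> powr q)" for A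
  proof -
    define S where "S = (\<Sum>i\<in>I. of_real (rademacher A i) * b i)"
    let ?x = "\<bar>\<Sum>i\<in>I. rademacher A i * (Re (b i) / s)\<bar>" and ?y = "\<bar>\<Sum>i\<in>I. rademacher A i * (Im (b i) / s)\<bar>"
    have x: "\<bar>Re S\<bar> = s * ?x"
    proof -
      have "Re S = s * (\<Sum>i\<in>I. rademacher A i * (Re (b i) / s))"
        using s by (simp add: S_def sum_distrib_left)
      then show ?thesis using s by (simp add: abs_mult)
    qed
    have y: "\<bar>Im S\<bar> = s * ?y"
    proof -
      have "Im S = s * (\<Sum>i\<in>I. rademacher A i * (Im (b i) / s))"
        using s by (simp add: S_def sum_distrib_left)
      then show ?thesis using s by (simp add: abs_mult)
    qed
    have "cmod S \<le> \<bar>Re S\<bar> + \<bar>Im S\<bar>" by (rule cmod_le)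
    also have "\<dots> = s * (?x + ?y)" unfolding x y by (rule distrib_left[symmetric])
    also have "\<dots> \<le> s * (2 * max ?x ?y)"
      using s by (intro mult_left_mono) auto
    finally have "cmod S powr q \<le> (s * (2 * max ?x ?y)) powr q"
      using q by (intro powr_mono2) auto
    also have "\<dots> = 2 powr q * s powr q * max ?x ?y powr q"
      using s by (simp add: powr_mult)
    also have "\<dots> \<le> 2 powr q * s powr q * (?x powr q + ?y powr q)"
      by (intro mult_left_mono) (auto simp: max_def)
    finally show ?thesis by (simp only: S_def)
  qed
  then have "(\<Sum>A\<in>Pow I. cmod (\<Sum>i\<in>I. of_real (rademacher A i) * b i) powr q)
      \<le> 2 powr q * s powr q * ((\<Sum>A\<in>Pow I. \<bar>\<Sum>i\<in>I. rademacher A i * (Re (b i) / s)\<bar> powr q)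
        + (\<Sum>A\<in>Pow I. \<bar>\<Sum>i\<in>I. rademacher A i * (Im (b i) / s)\<bar> powr q))"
    unfolding sum.distrib[symmetric] sum_distrib_left by (rule sum_mono)
  also have "\<dots> \<le> 2 powr q * s powr q * (2 * q powr q * exp 1 * 2 ^ card I + 2 * q powr q * exp 1 * 2 ^ card I)"
    by (intro mult_left_mono add_mono part abs_Re_le_cmod abs_Im_le_cmod) auto
  finally show ?thesis by (simp add: sq mult_ac)
qed

text \<open>Flipping the sign at \<open>i\<close> changes the sum by a number of modulus
  \<open>2 * cmod (b i)\<close>, so in each pair of patterns one sum has modulus at least
  \<open>cmod (b i)\<close>.\<close>

lemma sum_rademacher_powr_ge:
  fixes b :: "'i \<Rightarrow> complex" and p :: real
  assumes I: "finite I" "i \<in> I" and p: "0 < p"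
  shows "2 ^ card I * cmod (b i) powr p \<le> 2 * (\<Sum>A\<in>Pow I. cmod (\<Sum>j\<in>I. of_real (rademacher A j) * b j) powr p)"
proof -
  define S where "S A = (\<Sum>j\<in>I. of_real (rademacher A j) * b j)" for A
  define flip where "flip A = (if i \<in> A then A - {i} else insert i A)" for A
  have flip: "bij_betw flip (Pow I) (Pow I)"
    by (rule bij_betw_byWitness[where f' = flip]) (use I in \<open>auto simp: flip_def\<close>)
  have pair: "cmod (b i) powr p \<le> cmod (S A) powr p + cmod (S (flip A)) powr p" for A
  proof -
    have "S A - S (flip A) = (\<Sum>j\<in>I. of_real (rademacher A j - rademacher (flip A) j) * b j)"
      by (simp add: S_def sum_subtractf algebra_simps)
    also have "\<dots> = (\<Sum>j\<in>{i}. of_real (rademacher A j - rademacher (flip A) j) * b j)"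
      using I by (intro sum.mono_neutral_right) (auto simp: rademacher_def flip_def)
    finally have "cmod (S A - S (flip A)) = 2 * cmod (b i)"
      by (simp add: rademacher_def flip_def norm_mult)
    then have "2 * cmod (b i) \<le> cmod (S A) + cmod (S (flip A))"
      using norm_triangle_ineq4[of "S A" "S (flip A)"] by simp
    then have "cmod (b i) \<le> max (cmod (S A)) (cmod (S (flip A)))" by linarith
    then have "cmod (b i) powr p \<le> max (cmod (S A)) (cmod (S (flip A))) powr p"
      using p by (intro powr_mono2) auto
    also have "\<dots> \<le> cmod (S A) powr p + cmod (S (flip A)) powr p"
      by (auto simp: max_def)
    finally show ?thesis .
  qed
  have "2 ^ card I * cmod (b i) powr p = (\<Sum>A\<in>Pow I. cmod (b i) powr p)"
    using I by (simp add: card_Pow)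
  also have "\<dots> \<le> (\<Sum>A\<in>Pow I. cmod (S A) powr p + cmod (S (flip A)) powr p)"
    by (intro sum_mono pair)
  also have "\<dots> = 2 * (\<Sum>A\<in>Pow I. cmod (S A) powr p)"
    using sum.reindex_bij_betw[OF flip, of "\<lambda>A. cmod (S A) powr p"] by (simp add: sum.distrib)
  finally show ?thesis by (simp add: S_def)
qed

section \<open>Lattice geometry and lower bounds for images of kernels\<close>

lemma lattice_point_ball_disjoint:
  assumes "z \<in> ball (lattice_point i) (1/2)" "z \<in> ball (lattice_point j) (1/2)"
  shows "i = j"
proof -
  have "cmod (lattice_point i - lattice_point j) < 1"
    using assms dist_triangle[of "lattice_point i" "lattice_point j" z]
    by (simp add: dist_commute dist_norm[symmetric])
  then have "\<bar>real (fst i) - real (fst j)\<bar> < 1" "\<bar>real (snd i) - real (snd j)\<bar> < 1"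
    using abs_Re_le_cmod[of "lattice_point i - lattice_point j"] abs_Im_le_cmod[of "lattice_point i - lattice_point j"]
    by (auto simp: lattice_point_def)
  then show ?thesis by (intro prod_eqI) linarith+
qed

text \<open>On the triangle \<open>1 \<le> n \<le> m \<le> N\<close> the squared modulus is at most
  \<open>2 * m\<^sup>2\<close>, so the \<open>m\<close> points with first coordinate
  \<open>m\<close> contribute at least \<open>1 / (2 * m)\<close>, and the sum is at least half a
  harmonic number.\<close>

lemma sum_inverse_lattice_unbounded:
  obtains I where "finite I" "\<And>i. i \<in> I \<Longrightarrow> 1 \<le> cmod (lattice_point i)"
    "B < (\<Sum>i\<in>I. inverse (cmod (lattice_point i)) powr 2)"
proof -
  obtain N where N: "2 * B < harm N"
    using harm_at_top by (metis eventually_sequentially filterlim_at_top_dense order_refl)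
  define I where "I = (SIGMA m:{1..N}. {1..m})"
  have "harm N / 2 = (\<Sum>m=1..N. \<Sum>n=1..m. inverse (2 * real m ^ 2))"
    unfolding harm_def sum_divide_distrib
    by (intro sum.cong refl) (simp add: power2_eq_square field_simps)
  also have "\<dots> = (\<Sum>i\<in>I. inverse (2 * real (fst i) ^ 2))"
    unfolding I_def by (subst sum.Sigma) (auto intro: sum.cong)
  also have "\<dots> \<le> (\<Sum>i\<in>I. inverse (cmod (lattice_point i)) powr 2)"
  proof (intro sum_mono)
    fix i assume i: "i \<in> I"
    have "(real (snd i))\<^sup>2 \<le> (real (fst i))\<^sup>2" "0 < real (fst i)"
      using i by (auto simp: I_def intro!: power_mono)
    then have "inverse (2 * real (fst i) ^ 2) \<le> inverse ((cmod (lattice_point i))\<^sup>2)"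
      by (intro le_imp_inverse_le) (auto simp: cmod_power2 lattice_point_def intro: add_pos_nonneg)
    then show "inverse (2 * real (fst i) ^ 2) \<le> inverse (cmod (lattice_point i)) powr 2"
      by (simp add: power_inverse)
  qed
  finally have "B < (\<Sum>i\<in>I. inverse (cmod (lattice_point i)) powr 2)" using N by simp
  moreover have "1 \<le> cmod (lattice_point i)" if "i \<in> I" for i
    using that abs_Re_le_cmod[of "lattice_point i"] by (auto simp: I_def lattice_point_def)
  moreover have "finite I" by (simp add: I_def)
  ultimately show ?thesis using that by blast
qed

text \<open>For constant \<open>deriv g\<close> the image is explicit:
  \<open>b / (of_real \<alpha> * cnj w) * (k z - k 0)\<close> with \<open>k\<close> the kernel. Near
  \<open>w\<close> the weighted modulus of \<open>k z\<close> is at least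
  \<open>exp (- (\<alpha> / 8))\<close>, and that of \<open>k 0\<close> is smaller by the factor
  \<open>exp (- (\<alpha> / 2))\<close>, so they cannot cancel.\<close>

lemma volterra_kernel_lower_bound:
  fixes \<alpha> :: real
  assumes \<alpha>: "0 < \<alpha>" and b: "\<And>z. deriv g z = b" and w: "1 \<le> cmod w" and z: "z \<in> ball w (1/2)"
  shows "exp (- (\<alpha> / 8)) * (1 - exp (- (\<alpha> / 2))) / \<alpha> * cmod b * inverse (cmod w)
    \<le> fock_density \<alpha> (volterra g (fock_kernel \<alpha> w)) z"
proof -
  let ?k = "fock_kernel \<alpha> w"
  have w0: "w \<noteq> 0" using w by auto
  have "volterra g ?k z = b / (of_real \<alpha> * cnj w) * ?k z - b / (of_real \<alpha> * cnj w) * ?k 0"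
  proof (rule volterra_eq_primitive)
    fix z
    have "(?k has_field_derivative ?k z * (of_real \<alpha> * cnj w)) (at z)"
      unfolding fock_kernel_def[abs_def] by (auto intro!: derivative_eq_intros)
    then have "((\<lambda>z. b / (of_real \<alpha> * cnj w) * ?k z) has_field_derivative
        b / (of_real \<alpha> * cnj w) * (?k z * (of_real \<alpha> * cnj w))) (at z)"
      by (rule DERIV_cmult)
    then show "((\<lambda>z. b / (of_real \<alpha> * cnj w) * ?k z) has_field_derivative ?k z * deriv g z) (at z)"
      using w0 \<alpha> by (simp add: b mult.commute)
  qed
  then have "volterra g ?k z = b / (of_real \<alpha> * cnj w) * (?k z - ?k 0)"
    by (simp add: right_diff_distrib)
  then have "cmod (volterra g ?k z) = cmod b / (\<bar>\<alpha>\<bar> * cmod w) * cmod (?k z - ?k 0)"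
    by (simp only: norm_mult norm_divide complex_mod_cnj norm_of_real)
  then have norm: "cmod (volterra g ?k z) = cmod b * inverse (cmod w) / \<alpha> * cmod (?k z - ?k 0)"
    using \<alpha> by (simp add: field_simps)
  define G where "G = exp (- (\<alpha> / 2) * (cmod (z - w))\<^sup>2)"
  define e where "e = exp (- (\<alpha> / 2) * (cmod z)\<^sup>2)"
  have zw: "cmod (z - w) \<le> 1/2" using z by (simp add: dist_norm norm_minus_commute)
  have zw2: "(cmod (z - w))\<^sup>2 \<le> 1/4"
    using power_mono[OF zw, of 2] by (simp add: power2_eq_square)
  have "1/2 \<le> cmod z"
    using norm_triangle_ineq4[of z "z - w"] zw w by simp
  then have z2: "1/4 \<le> (cmod z)\<^sup>2"
    using power_mono[of "1/2" "cmod z" 2] by (simp add: power2_eq_square)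
  have w2: "1 \<le> (cmod w)\<^sup>2" using w by simp
  have kz: "cmod (?k z) * e = G"
    using fock_density_kernel[of \<alpha> w z] by (simp add: fock_density_def e_def G_def)
  \<comment> \<open>The squared moduli of \<open>w\<close> and \<open>z\<close> add up to at least
    \<open>1 + 1/4\<close>, which exceeds the bound for \<open>(cmod (z - w))\<^sup>2\<close> by 1;
    this 1 produces the gain \<open>exp (- (\<alpha> / 2))\<close>.\<close>
  have k0: "cmod (?k 0) * e \<le> G * exp (- (\<alpha> / 2))"
  proof -
    have "cmod (?k 0) = exp (- (\<alpha> / 2) * (cmod w)\<^sup>2)"
      using fock_density_kernel[of \<alpha> w 0] by (simp add: fock_density_def)
    moreover have "\<alpha> / 2 * ((cmod (z - w))\<^sup>2 + 1) \<le> \<alpha> / 2 * ((cmod w)\<^sup>2 + (cmod z)\<^sup>2)"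
      using \<alpha> zw2 z2 w2 by (intro mult_left_mono) auto
    ultimately show ?thesis
      by (simp add: e_def G_def exp_add[symmetric] distrib_left)
  qed
  have G: "exp (- (\<alpha> / 8)) \<le> G"
    unfolding G_def using mult_left_mono[OF zw2, of "\<alpha> / 2"] \<alpha> by simp
  have "exp (- (\<alpha> / 8)) * (1 - exp (- (\<alpha> / 2))) \<le> G * (1 - exp (- (\<alpha> / 2)))"
    using G \<alpha> by (intro mult_right_mono) auto
  also have "\<dots> \<le> cmod (?k z) * e - cmod (?k 0) * e"
    using k0 by (simp add: kz right_diff_distrib)
  also have "\<dots> = (cmod (?k z) - cmod (?k 0)) * e"
    by (simp add: left_diff_distrib)
  also have "\<dots> \<le> cmod (?k z - ?k 0) * e"
    by (intro mult_right_mono norm_triangle_ineq2) (auto simp: e_def)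
  finally have "cmod b * inverse (cmod w) / \<alpha> * (exp (- (\<alpha> / 8)) * (1 - exp (- (\<alpha> / 2))))
      \<le> cmod b * inverse (cmod w) / \<alpha> * (cmod (?k z - ?k 0) * e)"
    using \<alpha> by (intro mult_left_mono) auto
  then show ?thesis
    unfolding fock_density_def norm e_def[symmetric] by (simp only: mult_ac times_divide_eq_left times_divide_eq_right)
qed

subsection \<open>Constant derivative\<close>

lemma integral_indicator_ball:
  "integrable lborel (\<lambda>z::complex. c * indicator (ball w (1/2)) z :: real)"
  "(LINT z::complex|lborel. c * indicator (ball w (1/2)) z) = c * measure lborel (ball (0::complex) (1/2))"
proof -
  have "emeasure lborel (ball w (1/2)) < \<infinity>"
    by (simp add: emeasure_ball ennreal_mult_less_top)
  then show "integrable lborel (\<lambda>z. c * indicator (ball w (1/2)) z)"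
    by (intro integrable_mult_right) auto
  show "(LINT z|lborel. c * indicator (ball w (1/2)) z) = c * measure lborel (ball (0::complex) (1/2))"
    by (simp add: measure_def emeasure_ball)
qed

text \<open>From \<open>2 \<le> p\<close> follows \<open>p / (p - 1) \<le> 2\<close>, so the kernels
  themselves are weakly 2-summable. Integrating the lower bound over the ball around
  \<open>w\<close> shows that their images have norm at least a constant times
  \<open>inverse (cmod w)\<close>.\<close>

lemma sum_inverse_lattice_bounded_ge2:
  fixes \<alpha> p :: real
  assumes \<alpha>: "0 < \<alpha>" and p: "2 \<le> p" and b: "\<And>z. deriv g z = b" "b \<noteq> 0"
    and summing: "volterra_r_summing 2 \<alpha> p g"
  obtains B where "\<And>I. finite I \<Longrightarrow> (\<And>i. i \<in> I \<Longrightarrow> 1 \<le> cmod (lattice_point i)) \<Longrightarrow>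
    (\<Sum>i\<in>I. inverse (cmod (lattice_point i)) powr 2) \<le> B"
proof -
  have summing': "r_summing 2 (fock_space \<alpha> p) (fock_norm \<alpha> p) (fock_space \<alpha> p) (fock_norm \<alpha> p) (volterra g)"
    using summing by (simp add: volterra_r_summing_def)
  then have mem: "volterra g f \<in> fock_space \<alpha> p" if "f \<in> fock_space \<alpha> p" for f
    using that unfolding r_summing_def linear_operator_def by blast
  have ker: "fock_kernel \<alpha> w \<in> fock_space \<alpha> p" for w
    using \<alpha> p by (intro fock_kernel_in_fock_space) auto
  obtain K where K: "0 < K" and weak: "\<And>I \<phi>. finite I \<Longrightarrow> \<phi> \<in> dual_ball (fock_space \<alpha> p) (fock_norm \<alpha> p) \<Longrightarrow>
    (\<Sum>i\<in>I. cmod (\<phi> (fock_kernel \<alpha> (lattice_point i))) powr 2) \<le> K"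
  proof (rule fock_kernel_weakly_summable[OF \<alpha>])
    show "1 < p" "p / (p - 1) \<le> 2" using p by (auto simp: field_simps)
  qed blast
  obtain C where C: "0 < C" and le: "\<And>(I :: (nat \<times> nat) set) x B. finite I \<Longrightarrow> (\<And>i. i \<in> I \<Longrightarrow> x i \<in> fock_space \<alpha> p) \<Longrightarrow>
      (\<And>\<phi>. \<phi> \<in> dual_ball (fock_space \<alpha> p) (fock_norm \<alpha> p) \<Longrightarrow> (\<Sum>i\<in>I. cmod (\<phi> (x i)) powr 2) \<le> B) \<Longrightarrow>
      (\<Sum>i\<in>I. fock_norm \<alpha> p (volterra g (x i)) powr 2) \<le> C * B"
    by (rule r_summingD[OF summing' _ fock_norm_nonneg, where 'i = "nat \<times> nat"]) (simp, blast+)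
  define \<kappa> where "\<kappa> = exp (- (\<alpha> / 8)) * (1 - exp (- (\<alpha> / 2))) / \<alpha> * cmod b"
  define v where "v = measure lborel (ball (0::complex) (1/2))"
  have \<kappa>: "0 < \<kappa>" using \<alpha> b by (simp add: \<kappa>_def)
  have v: "0 < v" using content_ball_pos[of "1/2" "0::complex"] by (simp add: v_def)
  define e where "e = v powr (2 / p) * \<kappa> powr 2"
  have e: "0 < e" using v \<kappa> by (simp add: e_def)
  have lower: "e * inverse (cmod w) powr 2 \<le> fock_norm \<alpha> p (volterra g (fock_kernel \<alpha> w)) powr 2"
    if w: "1 \<le> cmod w" for w
  proof -
    let ?T = "volterra g (fock_kernel \<alpha> w)"
    have "(\<kappa> * inverse (cmod w)) powr p * v = (LINT z|lborel. (\<kappa> * inverse (cmod w)) powr p * indicator (ball w (1/2)) z)"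
      unfolding v_def by (rule integral_indicator_ball(2)[symmetric])
    also have "\<dots> \<le> (LINT z|lborel. fock_density \<alpha> ?T z powr p)"
    proof (rule integral_mono)
      show "integrable lborel (\<lambda>z. fock_density \<alpha> ?T z powr p)"
        using mem[OF ker] by (simp add: fock_space_iff)
      fix z
      show "(\<kappa> * inverse (cmod w)) powr p * indicator (ball w (1/2)) z \<le> fock_density \<alpha> ?T z powr p"
      proof (cases "z \<in> ball w (1/2)")
        case True
        then have "\<kappa> * inverse (cmod w) \<le> fock_density \<alpha> ?T z"
          unfolding \<kappa>_def by (intro volterra_kernel_lower_bound \<alpha> b w)
        then show ?thesis using True \<kappa> p by (auto intro!: powr_mono2)
      qed simp
    qed (rule integral_indicator_ball(1))
    also have "\<dots> = fock_norm \<alpha> p ?T powr p"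
      using p by (subst fock_norm_powr) auto
    finally have "((\<kappa> * inverse (cmod w)) powr p * v) powr (2 / p) \<le> (fock_norm \<alpha> p ?T powr p) powr (2 / p)"
      using p v by (intro powr_mono2) auto
    then show ?thesis
      using p v \<kappa> by (simp add: powr_mult powr_powr e_def mult_ac)
  qed
  have "(\<Sum>i\<in>I. inverse (cmod (lattice_point i)) powr 2) \<le> C * K / e"
    if I: "finite I" "\<And>i. i \<in> I \<Longrightarrow> 1 \<le> cmod (lattice_point i)" for I
  proof -
    have "e * (\<Sum>i\<in>I. inverse (cmod (lattice_point i)) powr 2)
        \<le> (\<Sum>i\<in>I. fock_norm \<alpha> p (volterra g (fock_kernel \<alpha> (lattice_point i))) powr 2)"
      unfolding sum_distrib_left using I by (intro sum_mono lower)
    also have "\<dots> \<le> C * K"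
      by (intro le weak ker I)
    finally show ?thesis using e by (simp add: field_simps)
  qed
  then show ?thesis by (rule that)
qed

text \<open>
  Hoelder's inequality for the exponents \<open>1 / 2 = (1 / p - 1 / 2) + (1 - 1 / p)\<close>; the weights
  \<open>l i powr (2 / p - 1)\<close> are those for which the bound for \<open>D\<close> below is self-improving.
\<close>

lemma weighted_square_sum_le:
  fixes l y :: "'i \<Rightarrow> real" and p W :: real
  assumes I: "finite I" and p: "1 < p" "p \<le> 2"
    and l: "\<And>i. i \<in> I \<Longrightarrow> 0 < l i" and y: "\<And>i. i \<in> I \<Longrightarrow> 0 \<le> y i"
    and W: "(\<Sum>i\<in>I. y i powr (p / (p - 1))) \<le> W" and D: "(\<Sum>i\<in>I. l i powr 2) = D" "0 < D"
  shows "(\<Sum>i\<in>I. (l i powr (2 / p - 1) * y i)\<^sup>2) \<le> D powr (2 / p - 1) * (1 + W)"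
proof -
  define s where "s = p / (p - 1)"
  define t where "t = s / 2"
  \<comment> \<open>This \<open>u\<close> makes both \<open>u * D\<close> and
    \<open>u powr (1 - t)\<close> equal to \<open>D powr (2 / p - 1)\<close>.\<close>
  define u where "u = D powr (- 1 / t)"
  have s: "2 \<le> s" "2 + s * (2 / p - 2) = 0" "1 - 2 / s = 2 / p - 1"
    using p by (auto simp: s_def field_simps)
  then have t: "1 \<le> t" "1 - 1 / t = 2 / p - 1" by (auto simp: t_def)
  have u: "0 < u" using D by (simp add: u_def)
  have uD: "u * D = D powr (2 / p - 1)"
    using D powr_mult_base[of D "- 1 / t"] t by (simp add: u_def mult.commute)
  have ut: "u powr (1 - t) = D powr (2 / p - 1)"
  proof -
    have "- 1 / t * (1 - t) = 2 / p - 1" using t by (simp add: field_simps)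
    then show ?thesis by (simp only: u_def powr_powr)
  qed
  have "(l i powr (2 / p - 1) * y i)\<^sup>2 \<le> u * l i powr 2 + u powr (1 - t) * y i powr s" if i: "i \<in> I" for i
  proof -
    \<comment> \<open>With \<open>l i powr 2\<close> factored out, the power \<open>t\<close> leaves
      \<open>l i\<close> with exponent \<open>2 + s * (2 / p - 2) = 0\<close>, so only
      \<open>y i powr s\<close> remains.\<close>
    define x where "x = (l i powr (2 / p - 2) * y i)\<^sup>2"
    have "l i powr (2 / p - 1) = l i * l i powr (2 / p - 2)"
      using powr_mult_base[of "l i" "2 / p - 2"] l[OF i] by simp
    then have eq: "(l i powr (2 / p - 1) * y i)\<^sup>2 = l i powr 2 * x"
      using l[OF i] by (simp add: x_def power_mult_distrib)
    have "x powr t = (l i powr (2 / p - 2) * y i) powr s"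
      using l[OF i] y[OF i] by (simp add: x_def t_def powr_powr powr_numeral[symmetric] del: powr_numeral)
    also have "\<dots> = l i powr (s * (2 / p - 2)) * y i powr s"
      using l[OF i] y[OF i] by (simp add: powr_mult powr_powr mult.commute)
    finally have "l i powr 2 * x powr t = l i powr (2 + s * (2 / p - 2)) * y i powr s"
      by (simp only: powr_add mult.assoc)
    then have xt: "l i powr 2 * x powr t = y i powr s"
      using l[OF i] by (simp add: s)
    have "l i powr 2 * x \<le> l i powr 2 * (u + u powr (1 - t) * x powr t)"
      using t u by (intro mult_left_mono le_split_powr) (auto simp: x_def)
    also have "\<dots> = u * l i powr 2 + u powr (1 - t) * (l i powr 2 * x powr t)"
      by (simp only: distrib_left mult_ac)
    finally show ?thesis unfolding eq xt .
  qed
  then have "(\<Sum>i\<in>I. (l i powr (2 / p - 1) * y i)\<^sup>2) \<le> (\<Sum>i\<in>I. u * l i powr 2 + u powr (1 - t) * y i powr s)"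
    by (intro sum_mono)
  also have "\<dots> = u * D + u powr (1 - t) * (\<Sum>i\<in>I. y i powr s)"
    by (simp add: sum.distrib sum_distrib_left D(1)[symmetric])
  also have "\<dots> \<le> u * D + u powr (1 - t) * W"
    using W by (intro add_left_mono mult_left_mono) (auto simp: s_def)
  finally show ?thesis
    by (simp only: uD ut distrib_left mult_1_right)
qed

text \<open>For \<open>p \<le> 2\<close> the conjugate exponent is at least 2, so the test family
  consists of all signed sums \<open>X A\<close> instead of single kernels. Khinchine and
  \<open>weighted_square_sum_le\<close> bound their weak \<open>q\<close>-sums. From below, on each
  of the disjoint balls around the lattice points, flipping one sign isolates the kernel centred
  there. Both sides contain powers of \<open>D\<close>, and comparing them bounds \<open>D\<close>
  independently of \<open>I\<close>.\<close>

lemma sum_inverse_lattice_bounded_le2: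
  fixes \<alpha> p q :: real
  assumes \<alpha>: "0 < \<alpha>" and p: "1 < p" "p \<le> 2" and q: "2 \<le> q" and b: "\<And>z. deriv g z = b" "b \<noteq> 0"
    and summing: "volterra_r_summing q \<alpha> p g"
  obtains B where "\<And>I. finite I \<Longrightarrow> (\<And>i. i \<in> I \<Longrightarrow> 1 \<le> cmod (lattice_point i)) \<Longrightarrow>
    (\<Sum>i\<in>I. inverse (cmod (lattice_point i)) powr 2) \<le> B"
proof -
  have summing': "r_summing q (fock_space \<alpha> p) (fock_norm \<alpha> p) (fock_space \<alpha> p) (fock_norm \<alpha> p) (volterra g)"
    using summing by (simp add: volterra_r_summing_def)
  then have lin: "linear_operator (fock_space \<alpha> p) (fock_space \<alpha> p) (volterra g)"
    unfolding r_summing_def by (rule conjunct1)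
  then have mem: "volterra g f \<in> fock_space \<alpha> p" if "f \<in> fock_space \<alpha> p" for f
    using that unfolding linear_operator_def by blast
  have ker: "fock_kernel \<alpha> w \<in> fock_space \<alpha> p" for w
    using \<alpha> p by (intro fock_kernel_in_fock_space) auto
  obtain W where W: "0 < W" and weak: "\<And>I \<phi>. finite I \<Longrightarrow> \<phi> \<in> dual_ball (fock_space \<alpha> p) (fock_norm \<alpha> p) \<Longrightarrow>
    (\<Sum>i\<in>I. cmod (\<phi> (fock_kernel \<alpha> (lattice_point i))) powr (p / (p - 1))) \<le> W"
    by (rule fock_kernel_weakly_summable[OF \<alpha> p(1) order_refl]) blast
  have q1: "1 \<le> q" using q by simp
  \<comment> \<open>Indexed by sets of lattice points, because the test vectors correspond to sign
    patterns.\<close>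
  obtain C where C: "0 < C" and le: "\<And>(I :: (nat \<times> nat) set set) x B. finite I \<Longrightarrow> (\<And>i. i \<in> I \<Longrightarrow> x i \<in> fock_space \<alpha> p) \<Longrightarrow>
      (\<And>\<phi>. \<phi> \<in> dual_ball (fock_space \<alpha> p) (fock_norm \<alpha> p) \<Longrightarrow> (\<Sum>i\<in>I. cmod (\<phi> (x i)) powr q) \<le> B) \<Longrightarrow>
      (\<Sum>i\<in>I. fock_norm \<alpha> p (volterra g (x i)) powr q) \<le> C * B"
    by (rule r_summingD[OF summing' q1 fock_norm_nonneg, where 'i = "(nat \<times> nat) set"]) blast+
  define \<kappa> where "\<kappa> = exp (- (\<alpha> / 8)) * (1 - exp (- (\<alpha> / 2))) / \<alpha> * cmod b"
  define v where "v = measure lborel (ball (0::complex) (1/2))"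
  have \<kappa>: "0 < \<kappa>" using \<alpha> b by (simp add: \<kappa>_def)
  have v: "0 < v" using content_ball_pos[of "1/2" "0::complex"] by (simp add: v_def)
  define e where "e = v * \<kappa> powr p / 4"
  have e: "0 < e" using v \<kappa> by (simp add: e_def)
  define K where "K = 4 * 2 powr q * q powr q * exp 1"
  define L where "L = C * K * (1 + W) powr (q / 2) / e powr (q / p)"
  have "(\<Sum>i\<in>I. inverse (cmod (lattice_point i)) powr 2) \<le> L powr (2 / q)"
    if I: "finite I" and I1: "\<And>i. i \<in> I \<Longrightarrow> 1 \<le> cmod (lattice_point i)" for I
  proof (cases "I = {}")
    case False
    define l where "l i = inverse (cmod (lattice_point i))" for i
    define D where "D = (\<Sum>i\<in>I. l i powr 2)"
    \<comment> \<open>The exponent makes \<open>(a i * l i) powr p\<close> equal to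
      \<open>l i powr 2\<close>, so that the lower bound sums to \<open>D\<close>; it is also the
      weight in \<open>weighted_square_sum_le\<close>.\<close>
    define a where "a i = l i powr (2 / p - 1)" for i
    define X where "X A z = (\<Sum>i\<in>I. of_real (rademacher A i * a i) * fock_kernel \<alpha> (lattice_point i) z)" for A z
    define Q where "Q = D powr (2 / p - 1) * (1 + W)"
    have l: "0 < l i" if "i \<in> I" for i
    proof -
      have "0 < cmod (lattice_point i)" using I1[OF that] by linarith
      then show ?thesis by (simp add: l_def)
    qed
    have D: "0 < D"
      unfolding D_def
    proof (rule sum_pos[OF I False])
      show "0 < l i powr 2" if "i \<in> I" for i using l[OF that] by simp
    qed
    have Q: "0 < Q" using D W by (simp add: Q_def)
    have X: "X A \<in> fock_space \<alpha> p" for A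
      unfolding X_def[abs_def] using p by (intro fock_space_sum I ker) auto
    have TX: "volterra g (X A) z = (\<Sum>i\<in>I. of_real (rademacher A i * a i) * volterra g (fock_kernel \<alpha> (lattice_point i)) z)" for A z
      unfolding X_def[abs_def] using p by (subst linear_operator_sum[OF lin _ I ker]) auto
    have upper: "(\<Sum>A\<in>Pow I. fock_norm \<alpha> p (volterra g (X A)) powr q) \<le> C * (K * 2 ^ card I * Q powr (q / 2))"
    proof (rule le)
      fix \<phi> assume \<phi>: "\<phi> \<in> dual_ball (fock_space \<alpha> p) (fock_norm \<alpha> p)"
      define y where "y i = \<phi> (fock_kernel \<alpha> (lattice_point i))" for i
      have "\<phi> (X A) = (\<Sum>i\<in>I. of_real (rademacher A i) * (of_real (a i) * y i))" for A
      proof -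
        have "\<phi> (X A) = (\<Sum>i\<in>I. of_real (rademacher A i * a i) * y i)"
          unfolding X_def[abs_def] y_def using p by (intro dual_ball_sum[OF \<phi>] I ker) auto
        then show ?thesis by (simp add: mult.assoc)
      qed
      moreover have "(\<Sum>i\<in>I. (cmod (of_real (a i) * y i))\<^sup>2) \<le> Q"
      proof -
        have "(\<Sum>i\<in>I. (l i powr (2 / p - 1) * cmod (y i))\<^sup>2) \<le> D powr (2 / p - 1) * (1 + W)"
          using weak[OF I \<phi>] by (intro weighted_square_sum_le I p l D) (auto simp: y_def D_def)
        then show ?thesis by (simp add: a_def Q_def norm_mult)
      qed
      ultimately show "(\<Sum>A\<in>Pow I. cmod (\<phi> (X A)) powr q) \<le> K * 2 ^ card I * Q powr (q / 2)"
        using khinchine[OF I _ Q, of q "\<lambda>i. of_real (a i) * y i"] q by (simp add: K_def)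
    qed (use I X in auto)
    have lower: "2 ^ card I * (2 * e * D) \<le> (\<Sum>A\<in>Pow I. fock_norm \<alpha> p (volterra g (X A)) powr p)"
    proof -
      have aL: "(a i * (\<kappa> * l i)) powr p = \<kappa> powr p * l i powr 2" if "i \<in> I" for i
      proof -
        have "a i * l i = l i powr (2 / p)"
          using powr_mult_base[of "l i" "2 / p - 1"] l[OF that] by (simp add: a_def mult.commute)
        then have "(a i * (\<kappa> * l i)) powr p = (\<kappa> * l i powr (2 / p)) powr p"
          by (simp add: mult_ac)
        then show ?thesis using \<kappa> p by (simp add: powr_mult powr_powr)
      qed
      let ?ind = "\<lambda>i. indicator (ball (lattice_point i) (1/2)) :: complex \<Rightarrow> real"
      let ?c = "\<lambda>i. 2 ^ card I / 2 * (\<kappa> powr p * l i powr 2)"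
      \<comment> \<open>The balls are disjoint, so at most one term on the left is nonzero, and
        \<open>sum_rademacher_powr_ge\<close> recovers the corresponding \<open>\<beta> i\<close>
        from the sum over all patterns.\<close>
      have pointwise: "(\<Sum>i\<in>I. ?c i * ?ind i z) \<le> (\<Sum>A\<in>Pow I. fock_density \<alpha> (volterra g (X A)) z powr p)" for z
      proof (cases "\<exists>i\<in>I. z \<in> ball (lattice_point i) (1/2)")
        case True
        then obtain i where i: "i \<in> I" "z \<in> ball (lattice_point i) (1/2)" by blast
        define E where "E = exp (- (\<alpha> / 2) * (cmod z)\<^sup>2)"
        define \<beta> where "\<beta> j = of_real (a j * E) * volterra g (fock_kernel \<alpha> (lattice_point j)) z" for j
        have dens: "fock_density \<alpha> (volterra g (X A)) z = cmod (\<Sum>j\<in>I. of_real (rademacher A j) * \<beta> j)" for A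
        proof -
          have "(\<Sum>j\<in>I. of_real (rademacher A j) * \<beta> j) = volterra g (X A) z * of_real E"
            unfolding TX \<beta>_def sum_distrib_right by (intro sum.cong refl) (simp add: mult_ac)
          then show ?thesis by (simp add: fock_density_def E_def norm_mult)
        qed
        have "(\<Sum>j\<in>I. ?c j * ?ind j z) = (\<Sum>j\<in>{i}. ?c j * ?ind j z)"
        proof (rule sum.mono_neutral_right)
          show "\<forall>j\<in>I - {i}. ?c j * ?ind j z = 0"
          proof
            fix j assume "j \<in> I - {i}"
            then have "z \<notin> ball (lattice_point j) (1/2)"
              using lattice_point_ball_disjoint[OF i(2), of j] by blast
            then show "?c j * ?ind j z = 0" by simp
          qed
        qed (use I i in auto)
        also have "\<dots> = 2 ^ card I / 2 * (a i * (\<kappa> * l i)) powr p"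
          using i by (simp add: aL)
        also have "\<dots> \<le> 2 ^ card I / 2 * cmod (\<beta> i) powr p"
        proof (intro mult_left_mono powr_mono2)
          have "\<kappa> * l i \<le> fock_density \<alpha> (volterra g (fock_kernel \<alpha> (lattice_point i))) z"
            unfolding \<kappa>_def l_def by (intro volterra_kernel_lower_bound \<alpha> b I1 i)
          then have "a i * (\<kappa> * l i) \<le> a i * fock_density \<alpha> (volterra g (fock_kernel \<alpha> (lattice_point i))) z"
            by (intro mult_left_mono) (auto simp: a_def)
          then show "a i * (\<kappa> * l i) \<le> cmod (\<beta> i)"
            by (simp add: \<beta>_def fock_density_def E_def norm_mult abs_mult a_def mult_ac)
        qed (use p \<kappa> l[OF i(1)] in \<open>auto simp: a_def\<close>)
        also have "\<dots> \<le> (\<Sum>A\<in>Pow I. fock_density \<alpha> (volterra g (X A)) z powr p)"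
          unfolding dens using sum_rademacher_powr_ge[OF I i(1), of p \<beta>] p by simp
        finally show ?thesis .
      next
        case False
        then have "(\<Sum>i\<in>I. ?c i * ?ind i z) = 0"
          by (intro sum.neutral ballI) simp
        then show ?thesis by (simp add: sum_nonneg)
      qed
      have int: "integrable lborel (\<lambda>z. fock_density \<alpha> (volterra g (X A)) z powr p)" for A
        using mem[OF X] by (simp add: fock_space_iff)
      have "2 ^ card I * (2 * e * D) = (\<Sum>i\<in>I. ?c i * v)"
        unfolding sum_distrib_right[symmetric] sum_distrib_left[symmetric] D_def[symmetric]
        by (simp add: e_def)
      also have "\<dots> = (LINT z|lborel. (\<Sum>i\<in>I. ?c i * ?ind i z))"
        unfolding v_def
        by (subst Bochner_Integration.integral_sum) (simp_all only: integral_indicator_ball)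
      also have "\<dots> \<le> (LINT z|lborel. (\<Sum>A\<in>Pow I. fock_density \<alpha> (volterra g (X A)) z powr p))"
        by (intro integral_mono pointwise Bochner_Integration.integrable_sum integral_indicator_ball(1) int)
      also have "\<dots> = (\<Sum>A\<in>Pow I. fock_norm \<alpha> p (volterra g (X A)) powr p)"
        using p by (subst Bochner_Integration.integral_sum) (auto simp: fock_norm_powr int)
      finally show ?thesis .
    qed
    \<comment> \<open>The passage from power \<open>p\<close> to power \<open>q\<close>: of the
      lower bound \<open>2 * u\<close> per pattern, one half pays for the constant term in
      \<open>le_split_powr\<close> and the other half remains for the \<open>q\<close>-sum.\<close>
    define u where "u = e * D"
    have u: "0 < u" using e D by (simp add: u_def)
    have "2 ^ card I * (2 * u) \<le> (\<Sum>A\<in>Pow I. u + u powr (1 - q / p) * (fock_norm \<alpha> p (volterra g (X A)) powr p) powr (q / p))"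
    proof -
      have "2 ^ card I * (2 * u) \<le> (\<Sum>A\<in>Pow I. fock_norm \<alpha> p (volterra g (X A)) powr p)"
        using lower by (simp add: u_def mult_ac)
      also have "\<dots> \<le> (\<Sum>A\<in>Pow I. u + u powr (1 - q / p) * (fock_norm \<alpha> p (volterra g (X A)) powr p) powr (q / p))"
        using u p q by (intro sum_mono le_split_powr) auto
      finally show ?thesis .
    qed
    also have "\<dots> = 2 ^ card I * u + u powr (1 - q / p) * (\<Sum>A\<in>Pow I. fock_norm \<alpha> p (volterra g (X A)) powr q)"
      using I p by (simp add: sum.distrib sum_distrib_left powr_powr card_Pow)
    also have "\<dots> \<le> 2 ^ card I * u + u powr (1 - q / p) * (C * (K * 2 ^ card I * Q powr (q / 2)))"
      by (intro add_left_mono mult_left_mono upper) auto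
    also have "\<dots> = 2 ^ card I * (u + u powr (1 - q / p) * (C * K * Q powr (q / 2)))"
      by (simp only: distrib_left mult_ac)
    finally have "2 * u \<le> u + u powr (1 - q / p) * (C * K * Q powr (q / 2))"
      by (subst (asm) mult_le_cancel_left_pos) auto
    then have "u \<le> u powr (1 - q / p) * (C * K * Q powr (q / 2))" by simp
    then have "u powr (q / p - 1) * u \<le> u powr (q / p - 1) * (u powr (1 - q / p) * (C * K * Q powr (q / 2)))"
      by (intro mult_left_mono) auto
    also have "\<dots> = u powr (q / p - 1 + (1 - q / p)) * (C * K * Q powr (q / 2))"
      by (simp only: powr_add mult.assoc)
    also have "u powr (q / p - 1) * u = u powr (q / p)"
      using powr_mult_base[of u "q / p - 1"] u by (simp add: mult.commute)
    finally have uq: "u powr (q / p) \<le> C * K * Q powr (q / 2)" using u by simp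
    \<comment> \<open>Against \<open>D powr (q / p)\<close> on the left, the exponent
      \<open>q / p - q / 2\<close> on the right leaves \<open>D powr (q / 2)\<close>, a positive
      power of \<open>D\<close>.\<close>
    have "Q powr (q / 2) = D powr (q / p - q / 2) * (1 + W) powr (q / 2)"
    proof -
      have "(2 / p - 1) * (q / 2) = q / p - q / 2" by (simp add: field_simps)
      moreover have "Q powr (q / 2) = (D powr (2 / p - 1)) powr (q / 2) * (1 + W) powr (q / 2)"
        using W by (simp add: Q_def powr_mult)
      ultimately show ?thesis by (simp only: powr_powr)
    qed
    also have "D powr (q / p - q / 2) = D powr (q / p) / D powr (q / 2)"
      by (rule powr_diff)
    finally have "e powr (q / p) * D powr (q / p) \<le> C * K * (D powr (q / p) / D powr (q / 2) * (1 + W) powr (q / 2))"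
      using uq e D by (simp add: u_def powr_mult)
    then have "D powr (q / 2) \<le> L"
    proof -
      have gen: "y \<le> c * z / e'" if "e' * x \<le> c * (x / y * z)" "0 < e'" "0 < x" "0 < y" for c e' x y z :: real
      proof -
        have "x * (e' * y) \<le> x * (c * z)" using that by (simp add: field_simps)
        then have "e' * y \<le> c * z" using that by simp
        then show ?thesis using that by (simp add: field_simps)
      qed
      show ?thesis unfolding L_def
        by (rule gen[where x = "D powr (q / p)"]) (use e D \<open>_ \<le> C * K * (_ / _ * _)\<close> in auto)
    qed
    then have "(D powr (q / 2)) powr (2 / q) \<le> L powr (2 / q)"
      using q by (intro powr_mono2) auto
    then show ?thesis
      using D q by (simp add: powr_powr D_def l_def)
  qed simp
  then show ?thesis by (rule that)
qed

text \<open>The exponent is raised to one that the two bounds accept: to \<open>max r 2\<close> if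
  \<open>p \<le> 2\<close>, and otherwise to 2, which is possible since then
  \<open>r \<le> 2\<close>. A nonzero \<open>b\<close> would bound the divergent lattice
  sum.\<close>

lemma volterra_r_summing_affine_imp_const:
  fixes \<alpha> p r :: real
  assumes \<alpha>: "0 < \<alpha>" and p: "1 < p" and r: "1 \<le> r" and pr: "p \<le> 2 \<or> r \<le> 2"
    and b: "\<And>z. deriv g z = b" and summing: "volterra_r_summing r \<alpha> p g"
  shows "b = 0"
proof (rule ccontr)
  assume b0: "b \<noteq> 0"
  obtain B where B: "\<And>I. finite I \<Longrightarrow> (\<And>i. i \<in> I \<Longrightarrow> 1 \<le> cmod (lattice_point i)) \<Longrightarrow>
    (\<Sum>i\<in>I. inverse (cmod (lattice_point i)) powr 2) \<le> B"
  proof (cases "p \<le> 2")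
    case True
    have "volterra_r_summing (max r 2) \<alpha> p g"
      by (rule volterra_r_summing_mono[OF summing]) (use r p in auto)
    then show ?thesis
      by (rule sum_inverse_lattice_bounded_le2[OF \<alpha> p True _ b b0, rotated]) (use that in auto)
  next
    case False
    have "volterra_r_summing 2 \<alpha> p g"
      by (rule volterra_r_summing_mono[OF summing]) (use r p pr False in auto)
    then show ?thesis
      by (rule sum_inverse_lattice_bounded_ge2[OF \<alpha> _ b b0, rotated]) (use that False in auto)
  qed
  obtain I where "finite I" "\<And>i. i \<in> I \<Longrightarrow> 1 \<le> cmod (lattice_point i)"
    "B < (\<Sum>i\<in>I. inverse (cmod (lattice_point i)) powr 2)"
    by (rule sum_inverse_lattice_unbounded) blast
  then show False using B[of I] by auto
qed

lemma volterra_const_r_summing: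
  assumes "1 \<le> r" "0 < p" "g holomorphic_on UNIV" and g: "\<And>z. deriv g z = 0"
  shows "volterra_r_summing r \<alpha> p g"
proof -
  have zero: "volterra g f = (\<lambda>z. 0)" for f
    by (simp add: volterra_def[abs_def] g)
  have "fock_norm \<alpha> p (\<lambda>z. 0) = 0"
    by (simp add: fock_norm_def fock_weighted_eq fock_density_def)
  then show ?thesis
    unfolding volterra_r_summing_def using assms(1,3)
    by (intro r_summingI[where C = 0] volterra_linear_operator) (auto simp: zero fock_space_zero)
qed

theorem theorem4p2:
  fixes \<alpha> p r :: real and g :: "complex \<Rightarrow> complex"
  assumes "\<alpha> > 0" and "p > 1" and "r \<ge> 1" and "g holomorphic_on UNIV"
  shows "(p \<le> 2 \<or> p > 2 \<and> r \<le> 2 \<longrightarrow> (volterra_r_summing r \<alpha> p g \<longleftrightarrow> g constant_on UNIV)) \<and>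
         (p > 2 \<and> r > 2 \<longrightarrow> (volterra_r_summing r \<alpha> p g \<longleftrightarrow> (\<exists>a b. \<forall>z. g z = a * z + b)))"
proof -
  have affine: "g z = a * z + g 0" if "\<And>z. deriv g z = a" for a z
  proof -
    have "((\<lambda>z. g z - a * z) has_field_derivative 0) (at z within UNIV)" for z
      using holomorphic_derivI[OF assms(4), of z UNIV] that
      by (auto intro!: derivative_eq_intros)
    then obtain c where "\<And>z. g z - a * z = c"
      using has_field_derivative_zero_constant[of UNIV "\<lambda>z. g z - a * z"] by auto
    from this[of z] this[of 0] show ?thesis by (simp add: algebra_simps)
  qed
  have deriv_affine: "deriv g z = a" if "\<forall>z. g z = a * z + b" for a b z
  proof -
    have "g = (\<lambda>z. a * z + b)" using that by auto
    then show ?thesis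
      by (auto intro!: DERIV_imp_deriv derivative_eq_intros)
  qed
  have forward: "volterra_r_summing r \<alpha> p g \<Longrightarrow> \<exists>a. \<forall>z. deriv g z = a"
    using volterra_r_summing_imp_deriv_const[OF assms] by metis
  have part1: "volterra_r_summing r \<alpha> p g \<longleftrightarrow> g constant_on UNIV" if pr: "p \<le> 2 \<or> p > 2 \<and> r \<le> 2"
  proof
    assume summing: "volterra_r_summing r \<alpha> p g"
    then obtain a where a: "\<And>z. deriv g z = a" using forward by auto
    have "a = 0"
      using assms pr a summing by (intro volterra_r_summing_affine_imp_const[of \<alpha> p r g]) auto
    then show "g constant_on UNIV"
      using affine[OF a] by (auto simp: constant_on_def)
  next
    assume "g constant_on UNIV"
    then obtain c where "\<forall>z. g z = 0 * z + c" by (auto simp: constant_on_def)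
    then have "deriv g z = 0" for z by (rule deriv_affine)
    then show "volterra_r_summing r \<alpha> p g"
      using assms by (intro volterra_const_r_summing) auto
  qed
  have part2: "volterra_r_summing r \<alpha> p g \<longleftrightarrow> (\<exists>a b. \<forall>z. g z = a * z + b)" if pr: "p > 2 \<and> r > 2"
  proof
    assume "volterra_r_summing r \<alpha> p g"
    then obtain a where "\<And>z. deriv g z = a" using forward by auto
    then show "\<exists>a b. \<forall>z. g z = a * z + b" using affine by metis
  next
    assume "\<exists>a b. \<forall>z. g z = a * z + b"
    then obtain a where a: "\<And>z. deriv g z = a" using deriv_affine by metis
    \<comment> \<open>The direct argument covers exponents up to \<open>p\<close>; a larger
      \<open>r\<close> is reached from \<open>p\<close> by monotonicity.\<close>
    have "volterra_r_summing (min r p) \<alpha> p g"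
      by (rule volterra_affine_r_summing[OF assms(1) _ _ assms(4) a]) (use pr in auto)
    then show "volterra_r_summing r \<alpha> p g"
      by (rule volterra_r_summing_mono) (use assms in auto)
  qed
  show ?thesis using part1 part2 by blast
qed

end
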